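(* Let $\Theta_1,\Theta_2$ be minimal L-systems (input-output space $\mathbb C$, $J=1$) satisfying Hypothesis I, and let $\Theta=\Theta_1\cdot\Theta_2$ be their coupling. Suppose that $V_{\Theta_1}\in\mathfrak M_{\kappa_1}$ and $V_{\Theta_2}\in\mathfrak M_{\kappa_2}$, $0\le\kappa_1,\kappa_2<1$. Then $V_\Theta\in\mathfrak M_{\kappa_1\kappa_2}$.
   Context: L-systems. Let $\dot A$ be a closed, densely defined symmetric operator with deficiency indices $(1,1)$ in a Hilbert space $\mathcal H$. Let $\mathcal H_+=\mathrm{Dom}(\dot A^* )$ with inner product $(f,g)_+=(f,g)+(\dot A^*f,\dot A^*g)$, and let $\mathcal H_+\subset\mathcal H\subset\mathcal H_-$ be the associated rigged Hilbert space ($\mathcal H_-$ is the dual of $\mathcal H_+$ with respect to the pairing extending the inner product of $\mathcal H$). For a bounded $\mathbb A:\mathcal H_+\to\mathcal H_-$ the adjoint $\mathbb A^*$ is again bounded $\mathcal H_+\to\mathcal H_-$; $\mathrm{Re}\,\mathbb A=(\mathbb A+\mathbb A^* )/2$, $\mathrm{Im}\,\mathbb A=(\mathbb A-\mathbb A^* )/(2i)$. An operator $T$ with $\dot A\subset T\subset\dot A^*$ belongs to $\Lambda(\dot A)$ if $\rho(T)\neq\emptyset$ and $\mathrm{Dom}(\dot A)=\mathrm{Dom}(T)\cap\mathrm{Dom}(T^* )$. A bounded $\mathbb A:\mathcal H_+\to\mathcal H_-$ is a $( * )$-extension of $T$ if $\mathbb A\supset T\supset\dot A$, $\mathbb A^*\supset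 T^*\supset\dot A$, and the quasi-kernel $\hat A$ of $\mathrm{Re}\,\mathbb A$ (the restriction of $\mathrm{Re}\,\mathbb A$ to $\{f\in\mathcal H_+:\mathrm{Re}\,\mathbb A f\in\mathcal H\}$) is self-adjoint in $\mathcal H$. An L-system is an array $\Theta=\begin{pmatrix}\mathbb A&K&1\\ \mathcal H_+\subset\mathcal H\subset\mathcal H_-&&\mathbb C\end{pmatrix}$, where $\mathbb A$ is a $( * )$-extension of some $T\in\Lambda(\dot A)$ (the main operator), $K:\mathbb C\to\mathcal H_-$ is bounded with adjoint $K^*:\mathcal H_+\to\mathbb C$, $\mathrm{Im}\,\mathbb A=KK^*$, $\mathrm{Ran}(K)=\mathrm{Ran}(\mathrm{Im}\,\mathbb A)$. It is minimal if $\dot A$ is prime (no nontrivial reducing subspace on which $\dot A$ induces a self-adjoint operator). Impedance function: $V_\Theta(z)=K^*(\mathrm{Re}\,\mathbb A-zI)^{-1}K$, $z\in\rho(\hat A)$ (well defined). Hypothesis I for an L-system: there are $g_\pm\in\ker(\dot A^*\mp iI)$, $\|g_\pm\|=1$, with $g_+-g_-\in\mathrm{Dom}(\hat A)$ and $g_+-\kappa g_-\in\mathrm{Dom}(T)$ for some $0\le\kappa<1$ ($T\neq T^*$ is then a maximal dissipative extension of $\dot A$). The number $\kappa$ is the von Neumann parameter of $T$. Class $\mathfrak M_\kappa$ ($0\le\kappa<1$): all analytic $M:\mathbb C_+\to\mathbb C_+$ of the form $M(z)=\int_{\mathbb R}\left(\frac1{\lambda-z}-\frac{\lambda}{1+\lambda^2}\right)d\mu(\lambda)$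 with $\mu$ an infinite Borel measure with $\int_{\mathbb R}\frac{d\mu(\lambda)}{1+\lambda^2}=\frac{1-\kappa}{1+\kappa}$ (equivalently $M(i)=i\frac{1-\kappa}{1+\kappa}$). Coupling. For $k=1,2$ let $\Theta_k$ act in $\mathcal H_k$, with symmetric operator $\dot A_k$, main operator $T_k$, and $g^k_\pm,\kappa_k$ as in Hypothesis I. Define $\alpha\in(0,\pi/2]$ by $\tan\alpha=\frac1{\kappa_2}\sqrt{\frac{1-\kappa_2^2}{1-\kappa_1^2}}$ if $\kappa_2\ne0$ and $\alpha=\pi/2$ if $\kappa_2=0$; define $\beta$ by $\sin\beta=\kappa_1\sin\alpha$, $\cos\beta=\frac1{\kappa_2}\cos\alpha$ if $\kappa_2\neq0$, and $\sin\beta=\kappa_1$, $\cos\beta=\sqrt{1-\kappa_1^2}$ if $\kappa_2=0$. Let $\dot A$ be the restriction of $(\dot A_1\oplus\dot A_2)^*$ to $\mathrm{Dom}(\dot A_1\oplus\dot A_2)\dot+\mathcal L_0$, where $\mathcal L_0$ is spanned by $\sin\alpha\,(g_+^1-\kappa_1g_-^1)\oplus\cos\alpha\,(g_+^2-\frac1{\kappa_2}g_-^2)$ if $\kappa_2\ne0$, and by $(g_+^1-\kappa_1g_-^1)\oplus(-\sqrt{1-\kappa_1^2}\,g_-^2)$ if $\kappa_2=0$. Then $\dot A$ is symmetric with deficiency indices $(1,1)$ in $\mathcal H_1\oplus\mathcal H_2$, with normalized deficiency vectors $G_+=\cos\alpha\,g_+^1-\sin\alpha\,g_+^2\in\ker(\dot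 A^*-iI)$ and $G_-=\cos\beta\,g_-^1-\sin\beta\,g_-^2\in\ker(\dot A^*+iI)$. The operator coupling $T=T_1\uplus T_2$ is the restriction of $(\dot A_1\oplus\dot A_2)^*$ to $\mathrm{Dom}(\dot A)\dot+\mathrm{span}\{G_+-\kappa_1\kappa_2G_-\}$, a maximal dissipative extension of $\dot A$. The coupling $\Theta=\Theta_1\cdot\Theta_2$ is the L-system with symmetric operator $\dot A$, main operator $T$, rigging $\mathcal H_+=\mathrm{Dom}(\dot A^* )\subset\mathcal H_1\oplus\mathcal H_2\subset\mathcal H_-$, state-space operator $\mathbb A$ the (unique) $( * )$-extension of $T$ such that the quasi-kernel of $\mathrm{Re}\,\mathbb A$ is the self-adjoint extension $\hat A$ of $\dot A$ with $G_+-G_-\in\mathrm{Dom}(\hat A)$, and $Kc=c\chi$ with $\mathrm{Im}\,\mathbb A=(\cdot,\chi)\chi$ ($\chi$ is determined up to a unimodular factor). *)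

theory Defs
  imports "HOL-Analysis.Analysis"
begin

section \<open>Complex Hilbert spaces\<close>

text \<open>The inner product is linear in the first argument and antilinear in the second.\<close>

class chilbert_space = banach +
  fixes scaleC :: "complex \<Rightarrow> 'a \<Rightarrow> 'a" (infixr \<open>*\<^sub>C\<close> 75)
    and cinner :: "'a \<Rightarrow> 'a \<Rightarrow> complex"
  assumes scaleC_add_right: "a *\<^sub>C (x + y) = a *\<^sub>C x + a *\<^sub>C y"
    and scaleC_add_left: "(a + b) *\<^sub>C x = a *\<^sub>C x + b *\<^sub>C x"
    and scaleC_scaleC: "a *\<^sub>C b *\<^sub>C x = (a * b) *\<^sub>C x"
    and scaleC_of_real: "complex_of_real r *\<^sub>C x = r *\<^sub>R x"
    and cinner_commute: "cinner x y = cnj (cinner y x)"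
    and cinner_add_left: "cinner (x + y) z = cinner x z + cinner y z"
    and cinner_scaleC_left: "cinner (a *\<^sub>C x) y = a * cinner x y"
    and cinner_self: "cinner x x = complex_of_real ((norm x)\<^sup>2)"

lemma scaleC_one: "1 *\<^sub>C x = (x :: 'a::chilbert_space)"
  using scaleC_of_real[of 1 x] by simp

global_interpretation complex_vector: vector_space "scaleC :: complex \<Rightarrow> 'a \<Rightarrow> 'a::chilbert_space"
  by unfold_locales
    (simp_all add: scaleC_add_right scaleC_add_left scaleC_scaleC scaleC_one)

text \<open>The orthogonal sum of two Hilbert spaces is their product type.\<close>

instantiation prod :: (chilbert_space, chilbert_space) chilbert_space
begin

definition scaleC_prod_def: "a *\<^sub>C p = (a *\<^sub>C fst p, a *\<^sub>C snd p)"

definition cinner_prod_def: "cinner p q = cinner (fst p) (fst q) + cinner (snd p) (snd q)"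

instance
proof
  fix a b :: complex and r :: real and x y z :: "'a \<times> 'b"
  show "a *\<^sub>C (x + y) = a *\<^sub>C x + a *\<^sub>C y"
    by (simp add: scaleC_prod_def scaleC_add_right)
  show "(a + b) *\<^sub>C x = a *\<^sub>C x + b *\<^sub>C x"
    by (simp add: scaleC_prod_def scaleC_add_left)
  show "a *\<^sub>C b *\<^sub>C x = (a * b) *\<^sub>C x"
    by (simp add: scaleC_prod_def scaleC_scaleC)
  show "complex_of_real r *\<^sub>C x = r *\<^sub>R x"
    by (simp add: scaleC_prod_def scaleC_of_real scaleR_prod_def)
  show "cinner x y = cnj (cinner y x)"
    by (simp add: cinner_prod_def flip: cinner_commute)
  show "cinner (x + y) z = cinner x z + cinner y z"
    by (simp add: cinner_prod_def cinner_add_left)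
  show "cinner (a *\<^sub>C x) y = a * cinner x y"
    by (simp add: cinner_prod_def scaleC_prod_def cinner_scaleC_left algebra_simps)
  show "cinner x x = complex_of_real ((norm x)\<^sup>2)"
    by (simp add: cinner_prod_def cinner_self norm_prod_def)
qed

end


section \<open>Unbounded operators\<close>

text \<open>
  An operator with a domain is identified with its graph, a subset of \<open>\<H> \<times> \<H>\<close>. Extension
  of operators is \<open>\<subseteq>\<close>, and \<^const>\<open>Domain\<close> and \<^const>\<open>single_valued\<close> have their usual meaning.
\<close>

type_synonym 'a operator = "('a \<times> 'a) set"

definition linear_operator :: "'a::chilbert_space operator \<Rightarrow> bool" where
  "linear_operator A \<longleftrightarrow> complex_vector.subspace A \<and> single_valued A"

definition densely_defined :: "'a::chilbert_space operator \<Rightarrow> bool" where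
  "densely_defined A \<longleftrightarrow> closure (Domain A) = UNIV"

definition op_app :: "'a operator \<Rightarrow> 'a \<Rightarrow> 'a" where
  "op_app A f = (THE g. (f, g) \<in> A)"

definition restrict_op :: "'a operator \<Rightarrow> 'a set \<Rightarrow> 'a operator" where
  "restrict_op A D = {(f, g) \<in> A. f \<in> D}"

text \<open>The adjoint of an operator that acts in the closed subspace \<open>M\<close>.\<close>

definition adjoint_in :: "'a::chilbert_space set \<Rightarrow> 'a operator \<Rightarrow> 'a operator" where
  "adjoint_in M A = {(u, v) \<in> M \<times> M. \<forall>(f, g) \<in> A. cinner g u = cinner f v}"

abbreviation adj :: "'a::chilbert_space operator \<Rightarrow> 'a operator" where
  "adj A \<equiv> adjoint_in UNIV A"

definition symmetric_op :: "'a::chilbert_space operator \<Rightarrow> bool" where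
  "symmetric_op A \<longleftrightarrow> linear_operator A \<and> densely_defined A \<and> A \<subseteq> adj A"

definition selfadjoint_in :: "'a::chilbert_space set \<Rightarrow> 'a operator \<Rightarrow> bool" where
  "selfadjoint_in M A \<longleftrightarrow>
    linear_operator A \<and> A \<subseteq> M \<times> M \<and> M \<subseteq> closure (Domain A) \<and> adjoint_in M A = A"

abbreviation selfadjoint :: "'a::chilbert_space operator \<Rightarrow> bool" where
  "selfadjoint A \<equiv> selfadjoint_in UNIV A"

definition eigenspace :: "'a::chilbert_space operator \<Rightarrow> complex \<Rightarrow> 'a set" where
  "eigenspace A z = {f. (f, z *\<^sub>C f) \<in> A}"

definition deficiency_indices_1_1 :: "'a::chilbert_space operator \<Rightarrow> bool" where
  "deficiency_indices_1_1 A \<longleftrightarrow>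
    complex_vector.dim (eigenspace (adj A) \<i>) = 1 \<and>
    complex_vector.dim (eigenspace (adj A) (- \<i>)) = 1"

definition resolvent_set :: "'a::chilbert_space operator \<Rightarrow> complex set" where
  "resolvent_set T = {z. (\<forall>h. \<exists>!f. (f, h + z *\<^sub>C f) \<in> T) \<and>
    (\<exists>C. \<forall>(f, g) \<in> T. norm f \<le> C * norm (g - z *\<^sub>C f))}"

definition orth_compl :: "'a::chilbert_space set \<Rightarrow> 'a set" where
  "orth_compl M = {f. \<forall>g \<in> M. cinner f g = 0}"

definition reducing_subspace :: "'a::chilbert_space operator \<Rightarrow> 'a set \<Rightarrow> bool" where
  "reducing_subspace A M \<longleftrightarrow> complex_vector.subspace M \<and> closed M \<and>
    A = {p + q | p q. p \<in> A \<inter> (M \<times> M) \<and> q \<in> A \<inter> (orth_compl M \<times> orth_compl M)}"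

definition prime_op :: "'a::chilbert_space operator \<Rightarrow> bool" where
  "prime_op A \<longleftrightarrow>
    \<not> (\<exists>M. M \<noteq> {0} \<and> reducing_subspace A M \<and> selfadjoint_in M (A \<inter> (M \<times> M)))"


section \<open>The rigged Hilbert space of a symmetric operator\<close>

definition hplus :: "'a::chilbert_space operator \<Rightarrow> 'a set" where
  "hplus A = Domain (adj A)"

definition cinner_plus :: "'a::chilbert_space operator \<Rightarrow> 'a \<Rightarrow> 'a \<Rightarrow> complex" where
  "cinner_plus A f g = cinner f g + cinner (op_app (adj A) f) (op_app (adj A) g)"

definition norm_plus :: "'a::chilbert_space operator \<Rightarrow> 'a \<Rightarrow> real" where
  "norm_plus A f = sqrt (Re (cinner_plus A f f))"

text \<open>
  An element \<open>\<phi>\<close> of \<open>\<H>\<^sub>-\<close> is identified with the bounded antilinear functional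
  \<open>f \<mapsto> (\<phi>, f)\<close> on \<open>\<H>\<^sub>+\<close>, extended by \<open>0\<close> to a total function so that equality in \<open>\<H>\<^sub>-\<close> is
  equality of functions. The pairing in the other order is \<open>(f, \<phi>) = cnj (\<phi> f)\<close>. With this
  identification the embedding \<open>\<H> \<subseteq> \<H>\<^sub>-\<close> below is linear.
\<close>

definition hminus :: "'a::chilbert_space operator \<Rightarrow> ('a \<Rightarrow> complex) set" where
  "hminus A = {\<phi>.
    (\<forall>f\<in>hplus A. \<forall>g\<in>hplus A. \<phi> (f + g) = \<phi> f + \<phi> g) \<and>
    (\<forall>c. \<forall>f\<in>hplus A. \<phi> (c *\<^sub>C f) = cnj c * \<phi> f) \<and>
    (\<exists>C. \<forall>f\<in>hplus A. cmod (\<phi> f) \<le> C * norm_plus A f) \<and>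
    (\<forall>f. f \<notin> hplus A \<longrightarrow> \<phi> f = 0)}"

definition norm_minus :: "'a::chilbert_space operator \<Rightarrow> ('a \<Rightarrow> complex) \<Rightarrow> real" where
  "norm_minus A \<phi> = (SUP f \<in> {f \<in> hplus A. norm_plus A f \<le> 1}. cmod (\<phi> f))"

definition emb :: "'a::chilbert_space operator \<Rightarrow> 'a \<Rightarrow> ('a \<Rightarrow> complex)" where
  "emb A h = (\<lambda>f. if f \<in> hplus A then cinner h f else 0)"

text \<open>
  Maps \<open>B : \<H>\<^sub>+ \<rightarrow> \<H>\<^sub>-\<close> are likewise extended by \<open>0\<close>; thus \<open>B f g\<close> is the pairing \<open>(B f, g)\<close>.
\<close>

definition bounded_plus_minus ::
    "'a::chilbert_space operator \<Rightarrow> ('a \<Rightarrow> 'a \<Rightarrow> complex) \<Rightarrow> bool" where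
  "bounded_plus_minus A B \<longleftrightarrow>
    (\<forall>f\<in>hplus A. B f \<in> hminus A) \<and>
    (\<forall>f\<in>hplus A. \<forall>g\<in>hplus A. B (f + g) = (\<lambda>h. B f h + B g h)) \<and>
    (\<forall>c. \<forall>f\<in>hplus A. B (c *\<^sub>C f) = (\<lambda>h. c * B f h)) \<and>
    (\<exists>C. \<forall>f\<in>hplus A. norm_minus A (B f) \<le> C * norm_plus A f) \<and>
    (\<forall>f. f \<notin> hplus A \<longrightarrow> B f = (\<lambda>h. 0))"

text \<open>\<open>(B\<^sup>* f, g) = cnj (g, B\<^sup>* f) = cnj (B g, f)\<close>.\<close>

definition adj_pm :: "('a \<Rightarrow> 'a \<Rightarrow> complex) \<Rightarrow> ('a \<Rightarrow> 'a \<Rightarrow> complex)" where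
  "adj_pm B = (\<lambda>f g. cnj (B g f))"

definition Re_pm :: "('a \<Rightarrow> 'a \<Rightarrow> complex) \<Rightarrow> ('a \<Rightarrow> 'a \<Rightarrow> complex)" where
  "Re_pm B = (\<lambda>f g. (B f g + adj_pm B f g) / 2)"

definition Im_pm :: "('a \<Rightarrow> 'a \<Rightarrow> complex) \<Rightarrow> ('a \<Rightarrow> 'a \<Rightarrow> complex)" where
  "Im_pm B = (\<lambda>f g. (B f g - adj_pm B f g) / (2 * \<i>))"

text \<open>\<open>extends_op A B T\<close> says that \<open>B : \<H>\<^sub>+ \<rightarrow> \<H>\<^sub>-\<close> extends the operator \<open>T\<close> in \<open>\<H>\<close>.\<close>

definition extends_op ::
    "'a::chilbert_space operator \<Rightarrow> ('a \<Rightarrow> 'a \<Rightarrow> complex) \<Rightarrow> 'a operator \<Rightarrow> bool" where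
  "extends_op A B T \<longleftrightarrow> (\<forall>(f, g) \<in> T. f \<in> hplus A \<and> B f = emb A g)"

definition quasi_kernel ::
    "'a::chilbert_space operator \<Rightarrow> ('a \<Rightarrow> 'a \<Rightarrow> complex) \<Rightarrow> 'a operator" where
  "quasi_kernel A B = {(f, g). f \<in> hplus A \<and> B f = emb A g}"

definition Lambda_class :: "'a::chilbert_space operator \<Rightarrow> 'a operator set" where
  "Lambda_class A = {T. linear_operator T \<and> A \<subseteq> T \<and> T \<subseteq> adj A \<and>
    resolvent_set T \<noteq> {} \<and> Domain A = Domain T \<inter> Domain (adj T)}"

definition star_extension ::
    "'a::chilbert_space operator \<Rightarrow> 'a operator \<Rightarrow> ('a \<Rightarrow> 'a \<Rightarrow> complex) \<Rightarrow> bool" where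
  "star_extension A T B \<longleftrightarrow> bounded_plus_minus A B \<and>
    extends_op A B T \<and> A \<subseteq> T \<and>
    extends_op A (adj_pm B) (adj T) \<and> A \<subseteq> adj T \<and>
    selfadjoint (quasi_kernel A (Re_pm B))"


section \<open>L-systems with input-output space \<open>\<complex>\<close> and \<open>J = 1\<close>\<close>

record 'a lsystem =
  sym_op :: "'a operator"
  main_op :: "'a operator"
  state_op :: "'a \<Rightarrow> 'a \<Rightarrow> complex"
  channel :: "complex \<Rightarrow> ('a \<Rightarrow> complex)"

definition bounded_channel ::
    "'a::chilbert_space operator \<Rightarrow> (complex \<Rightarrow> ('a \<Rightarrow> complex)) \<Rightarrow> bool" where
  "bounded_channel A K \<longleftrightarrow>
    (\<forall>c. K c \<in> hminus A) \<and>
    (\<forall>c d. K (c + d) = (\<lambda>f. K c f + K d f)) \<and>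
    (\<forall>c d. K (c * d) = (\<lambda>f. c * K d f)) \<and>
    (\<exists>C. \<forall>c. norm_minus A (K c) \<le> C * cmod c)"

definition adj_channel :: "(complex \<Rightarrow> ('a \<Rightarrow> complex)) \<Rightarrow> 'a \<Rightarrow> complex" where
  "adj_channel K f = cnj (K 1 f)"

text \<open>The defining identity \<open>(K c, f) = (c, K\<^sup>* f)\<close> of the adjoint.\<close>

lemma adj_channel:
  assumes "bounded_channel A K"
  shows "K c f = c * cnj (adj_channel K f)"
proof -
  have "K (c * 1) = (\<lambda>f. c * K 1 f)"
    using assms unfolding bounded_channel_def by blast
  then show ?thesis by (simp add: adj_channel_def)
qed

definition is_lsystem :: "'a::chilbert_space lsystem \<Rightarrow> bool" where
  "is_lsystem \<Theta> \<longleftrightarrow>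
    symmetric_op (sym_op \<Theta>) \<and> closed (sym_op \<Theta>) \<and> deficiency_indices_1_1 (sym_op \<Theta>) \<and>
    main_op \<Theta> \<in> Lambda_class (sym_op \<Theta>) \<and>
    star_extension (sym_op \<Theta>) (main_op \<Theta>) (state_op \<Theta>) \<and>
    bounded_channel (sym_op \<Theta>) (channel \<Theta>) \<and>
    (\<forall>f\<in>hplus (sym_op \<Theta>).
      Im_pm (state_op \<Theta>) f = channel \<Theta> (adj_channel (channel \<Theta>) f)) \<and>
    range (channel \<Theta>) = Im_pm (state_op \<Theta>) ` hplus (sym_op \<Theta>)"

definition minimal_lsystem :: "'a::chilbert_space lsystem \<Rightarrow> bool" where
  "minimal_lsystem \<Theta> \<longleftrightarrow> is_lsystem \<Theta> \<and> prime_op (sym_op \<Theta>)"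

abbreviation quasi_kernel_ls :: "'a::chilbert_space lsystem \<Rightarrow> 'a operator" where
  "quasi_kernel_ls \<Theta> \<equiv> quasi_kernel (sym_op \<Theta>) (Re_pm (state_op \<Theta>))"

text \<open>
  \<open>V\<^sub>\<Theta>(z) = K\<^sup>* (Re \<A> - z I)\<^sup>-\<^sup>1 K\<close>, an operator on \<open>\<complex>\<close> identified with its value at \<open>1\<close>; it is
  meaningful for \<open>z\<close> in the resolvent set of the quasi-kernel.
\<close>

definition impedance :: "'a::chilbert_space lsystem \<Rightarrow> complex \<Rightarrow> complex" where
  "impedance \<Theta> z = adj_channel (channel \<Theta>)
    (inv_into (hplus (sym_op \<Theta>))
      (\<lambda>f h. Re_pm (state_op \<Theta>) f h - z * emb (sym_op \<Theta>) f h) (channel \<Theta> 1))"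

definition hypothesis_I :: "'a::chilbert_space lsystem \<Rightarrow> 'a \<Rightarrow> 'a \<Rightarrow> real \<Rightarrow> bool" where
  "hypothesis_I \<Theta> gp gm \<kappa> \<longleftrightarrow>
    gp \<in> eigenspace (adj (sym_op \<Theta>)) \<i> \<and> norm gp = 1 \<and>
    gm \<in> eigenspace (adj (sym_op \<Theta>)) (- \<i>) \<and> norm gm = 1 \<and>
    0 \<le> \<kappa> \<and> \<kappa> < 1 \<and>
    gp - gm \<in> Domain (quasi_kernel_ls \<Theta>) \<and>
    gp - \<kappa> *\<^sub>R gm \<in> Domain (main_op \<Theta>)"


section \<open>The class \<open>\<MM>\<^sub>\<kappa>\<close>\<close>

definition class_M :: "real \<Rightarrow> (complex \<Rightarrow> complex) set" where
  "class_M \<kappa> = {M. 0 \<le> \<kappa> \<and> \<kappa> < 1 \<and>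
    M analytic_on {z. Im z > 0} \<and>
    (\<forall>z. Im z > 0 \<longrightarrow> Im (M z) > 0) \<and>
    (\<exists>\<mu> :: real measure. sets \<mu> = sets borel \<and> emeasure \<mu> UNIV = \<infinity> \<and>
      (\<integral>\<^sup>+ x. ennreal (1 / (1 + x\<^sup>2)) \<partial>\<mu>) = ennreal ((1 - \<kappa>) / (1 + \<kappa>)) \<and>
      (\<forall>z. Im z > 0 \<longrightarrow> M z = (LINT x|\<mu>.
        1 / (complex_of_real x - z) - complex_of_real (x / (1 + x\<^sup>2)))))}"


section \<open>Coupling\<close>

definition op_sum ::
    "'a::chilbert_space operator \<Rightarrow> 'b::chilbert_space operator \<Rightarrow> ('a \<times> 'b) operator" where
  "op_sum A\<^sub>1 A\<^sub>2 = {((f\<^sub>1, f\<^sub>2), (g\<^sub>1, g\<^sub>2)) | f\<^sub>1 f\<^sub>2 g\<^sub>1 g\<^sub>2. (f\<^sub>1, g\<^sub>1) \<in> A\<^sub>1 \<and> (f\<^sub>2, g\<^sub>2) \<in> A\<^sub>2}"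

definition dom_plus_span :: "'a::chilbert_space operator \<Rightarrow> 'a \<Rightarrow> 'a set" where
  "dom_plus_span A l = {f + v | f v. f \<in> Domain A \<and> v \<in> complex_vector.span {l}}"

definition coupling_angles :: "real \<Rightarrow> real \<Rightarrow> real \<Rightarrow> real \<Rightarrow> bool" where
  "coupling_angles \<kappa>\<^sub>1 \<kappa>\<^sub>2 \<alpha> \<beta> \<longleftrightarrow> 0 < \<alpha> \<and> \<alpha> \<le> pi / 2 \<and>
    (if \<kappa>\<^sub>2 \<noteq> 0
     then tan \<alpha> = 1 / \<kappa>\<^sub>2 * sqrt ((1 - \<kappa>\<^sub>2\<^sup>2) / (1 - \<kappa>\<^sub>1\<^sup>2)) \<and>
       sin \<beta> = \<kappa>\<^sub>1 * sin \<alpha> \<and> cos \<beta> = 1 / \<kappa>\<^sub>2 * cos \<alpha>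
     else \<alpha> = pi / 2 \<and> sin \<beta> = \<kappa>\<^sub>1 \<and> cos \<beta> = sqrt (1 - \<kappa>\<^sub>1\<^sup>2))"

definition coupling_vector ::
    "real \<Rightarrow> real \<Rightarrow> real \<Rightarrow> 'a::chilbert_space \<Rightarrow> 'a \<Rightarrow> 'b::chilbert_space \<Rightarrow> 'b \<Rightarrow> 'a \<times> 'b" where
  "coupling_vector \<kappa>\<^sub>1 \<kappa>\<^sub>2 \<alpha> gp\<^sub>1 gm\<^sub>1 gp\<^sub>2 gm\<^sub>2 =
    (if \<kappa>\<^sub>2 \<noteq> 0
     then (sin \<alpha> *\<^sub>R (gp\<^sub>1 - \<kappa>\<^sub>1 *\<^sub>R gm\<^sub>1), cos \<alpha> *\<^sub>R (gp\<^sub>2 - (1 / \<kappa>\<^sub>2) *\<^sub>R gm\<^sub>2))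
     else (gp\<^sub>1 - \<kappa>\<^sub>1 *\<^sub>R gm\<^sub>1, - sqrt (1 - \<kappa>\<^sub>1\<^sup>2) *\<^sub>R gm\<^sub>2))"

definition coupling_sym_op ::
    "'a::chilbert_space operator \<Rightarrow> 'b::chilbert_space operator \<Rightarrow> 'a \<times> 'b \<Rightarrow> ('a \<times> 'b) operator" where
  "coupling_sym_op A\<^sub>1 A\<^sub>2 l =
    restrict_op (adj (op_sum A\<^sub>1 A\<^sub>2)) (dom_plus_span (op_sum A\<^sub>1 A\<^sub>2) l)"

text \<open>
  \<open>is_coupling \<Theta>\<^sub>1 gp\<^sub>1 gm\<^sub>1 \<kappa>\<^sub>1 \<Theta>\<^sub>2 gp\<^sub>2 gm\<^sub>2 \<kappa>\<^sub>2 \<Theta>\<close> says that \<open>\<Theta> = \<Theta>\<^sub>1 \<cdot> \<Theta>\<^sub>2\<close>, up to the unimodular factor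
  that the channel vector leaves free. For an L-system, linearity of \<open>K\<close> and \<open>Im \<A> = K K\<^sup>*\<close>
  already give \<open>K c = c \<chi>\<close> and \<open>Im \<A> = (\<cdot>, \<chi>) \<chi>\<close> with \<open>\<chi> = K 1\<close>.
\<close>

definition is_coupling ::
    "'a::chilbert_space lsystem \<Rightarrow> 'a \<Rightarrow> 'a \<Rightarrow> real \<Rightarrow>
     'b::chilbert_space lsystem \<Rightarrow> 'b \<Rightarrow> 'b \<Rightarrow> real \<Rightarrow> ('a \<times> 'b) lsystem \<Rightarrow> bool" where
  "is_coupling \<Theta>\<^sub>1 gp\<^sub>1 gm\<^sub>1 \<kappa>\<^sub>1 \<Theta>\<^sub>2 gp\<^sub>2 gm\<^sub>2 \<kappa>\<^sub>2 \<Theta> \<longleftrightarrow>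
    (\<exists>\<alpha> \<beta>. coupling_angles \<kappa>\<^sub>1 \<kappa>\<^sub>2 \<alpha> \<beta> \<and>
      (let A\<^sub>1 = sym_op \<Theta>\<^sub>1;
           A\<^sub>2 = sym_op \<Theta>\<^sub>2;
           A = coupling_sym_op A\<^sub>1 A\<^sub>2 (coupling_vector \<kappa>\<^sub>1 \<kappa>\<^sub>2 \<alpha> gp\<^sub>1 gm\<^sub>1 gp\<^sub>2 gm\<^sub>2);
           Gp = (cos \<alpha> *\<^sub>R gp\<^sub>1, - sin \<alpha> *\<^sub>R gp\<^sub>2);
           Gm = (cos \<beta> *\<^sub>R gm\<^sub>1, - sin \<beta> *\<^sub>R gm\<^sub>2);
           T = restrict_op (adj (op_sum A\<^sub>1 A\<^sub>2)) (dom_plus_span A (Gp - (\<kappa>\<^sub>1 * \<kappa>\<^sub>2) *\<^sub>R Gm))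
       in is_lsystem \<Theta> \<and> sym_op \<Theta> = A \<and> main_op \<Theta> = T \<and>
          Gp - Gm \<in> Domain (quasi_kernel_ls \<Theta>)))"

end

theory Submission
  imports Defs "HOL-Probability.Probability" "HOL-Complex_Analysis.Cauchy_Integral_Formula"
begin

text \<open>
  The coupling is itself an L-system satisfying Hypothesis I, with deficiency vectors \<open>G\<^sub>+\<close>, \<open>G\<^sub>-\<close> and
  parameter \<open>\<kappa> = \<kappa>\<^sub>1 \<kappa>\<^sub>2\<close>, so it suffices to compute the impedance of one such system. Comparing the
  values of \<open>Re \<A>\<close> at \<open>g\<^sub>+ - \<kappa> g\<^sub>-\<close> (in the domain of \<open>T\<close>), at \<open>\<kappa> g\<^sub>+ - g\<^sub>-\<close> (in that of \<open>T\<^sup>*\<close>) and at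
  \<open>g\<^sub>+ - g\<^sub>-\<close> (in that of the quasi-kernel \<open>Q\<close>) gives
  \<open>V(z) = (1 - \<kappa>) / (1 + \<kappa>) (z + (z\<^sup>2 + 1) ((Q - z)\<^sup>-\<^sup>1 g\<^sub>+, g\<^sub>+))\<close>.

  The representing measure comes from the Cayley transform \<open>U\<close> of \<open>Q\<close>: a weak limit of Fejer means is a
  measure on the circle with moments \<open>(U\<^sup>k g\<^sub>+, g\<^sub>+)\<close>, which \<open>x = cot (\<theta> / 2)\<close> moves to the line. It has no
  mass at infinity because \<open>Q\<close> is densely defined, and infinite second moment because \<open>g\<^sub>+\<close> is a nonzero
  solution of \<open>A\<^sup>* g = \<i> g\<close> for the densely defined \<open>A \<subseteq> Q\<close>.
\<close>

section \<open>Complex Hilbert spaces\<close>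

text \<open>No spectral theorem for \<open>Q\<close> is needed: the impedance sees only the scalar
  spectral measure of the single unit vector \<open>gp\<close>, and that measure is fixed by the
  moments of an everywhere defined isometry. The price is the point 1 of the circle, which the
  cotangent sends to infinity; an atom there would add to V a term linear in z, which the integral
  form of the class does not allow.

  The other obstacle is that the real part of the state operator maps \<open>gp\<close> outside the
  Hilbert space and that the channel is not given explicitly. Both are controlled because the
  imaginary part has rank one: on the domains of T and of its adjoint, the real part differs from a
  known vector by a multiple of \<open>K 1\<close>. The functional adjoint to the channel is then
  known up to a phase, with squared modulus 1 - \<kappa>^2 at \<open>gp - \<kappa> gm\<close>. This
  modulus is all that enters V, so the free unimodular factor of the channel cancels, and (1 -
  \<kappa>) / (1 + \<kappa>) appears as (1 - \<kappa>)^2 / (1 - \<kappa>^2).\<close>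

lemma cinner_scaleC_right: "cinner x (a *\<^sub>C y) = cnj a * cinner x y"
  by (metis cinner_commute cinner_scaleC_left complex_cnj_mult)

lemma norm_scaleC: "norm (a *\<^sub>C x) = cmod a * norm (x :: 'a::chilbert_space)"
proof -
  have "complex_of_real ((norm (a *\<^sub>C x))\<^sup>2) = a * (cnj a * complex_of_real ((norm x)\<^sup>2))"
    by (simp only: cinner_self[symmetric] cinner_scaleC_left cinner_scaleC_right mult.left_commute)
  also have "\<dots> = complex_of_real ((cmod a * norm x)\<^sup>2)"
    by (simp add: power_mult_distrib flip: complex_norm_square mult.assoc)
  finally have "(norm (a *\<^sub>C x))\<^sup>2 = (cmod a * norm x)\<^sup>2"
    using of_real_eq_iff by blast
  then show ?thesis
    by (simp add: power2_eq_iff_nonneg)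
qed

lemma cinner_expand:
  "(norm (x + a *\<^sub>C y))\<^sup>2 = (norm x)\<^sup>2 + 2 * Re (cnj a * cinner x y) + (cmod a * norm y)\<^sup>2"
proof -
  have right: "cinner u (v + w) = cinner u v + cinner u w" for u v w :: 'a
    by (metis cinner_add_left cinner_commute complex_cnj_add)
  have "complex_of_real ((norm (x + a *\<^sub>C y))\<^sup>2)
      = cinner x x + (cnj a * cinner x y + cnj (cnj a * cinner x y)) + cinner (a *\<^sub>C y) (a *\<^sub>C y)"
    unfolding cinner_self[symmetric]
    by (simp add: right cinner_add_left cinner_scaleC_right cinner_scaleC_left
        cinner_commute[of y x] distrib_left)
  also have "\<dots> = complex_of_real
      ((norm x)\<^sup>2 + 2 * Re (cnj a * cinner x y) + (cmod a * norm y)\<^sup>2)"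
    by (simp add: cinner_self norm_scaleC complex_add_cnj del: complex_cnj_mult)
  finally show ?thesis
    using of_real_eq_iff by blast
qed

text \<open>The vector on the left is \<open>x\<close> minus its projection onto the line through
  \<open>y\<close>. Nonnegativity of the right side gives Cauchy-Schwarz; its drop below the squared
  norm of \<open>x\<close> makes a closest point orthogonal.\<close>

lemma norm_residual:
  assumes "y \<noteq> (0 :: 'a::chilbert_space)"
  shows "(norm (x + (- cinner x y / (norm y)\<^sup>2) *\<^sub>C y))\<^sup>2 = (norm x)\<^sup>2 - (cmod (cinner x y) / norm y)\<^sup>2"
proof -
  define c where "c = cinner x y"
  define n where "n = (norm y)\<^sup>2"
  have n: "n > 0"
    using assms by (simp add: n_def)
  have eq: "- c / complex_of_real n = complex_of_real (- 1 / n) * c"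
    by simp
  have "cnj (- c / complex_of_real n) * c = complex_of_real (- 1 / n) * (c * cnj c)"
    unfolding eq by (simp add: mult.commute)
  also have "\<dots> = complex_of_real (- ((cmod c)\<^sup>2 / n))"
    unfolding complex_norm_square[symmetric] by simp
  finally have 1: "Re (cnj (- c / complex_of_real n) * c) = - ((cmod c)\<^sup>2 / n)"
    by (simp only: Re_complex_of_real)
  have "cmod (- c / complex_of_real n) = cmod c / n"
    using n by (simp add: norm_divide)
  then have 2: "(cmod (- c / complex_of_real n) * norm y)\<^sup>2 = (cmod c)\<^sup>2 / n"
    using n by (simp add: power_mult_distrib power_divide flip: n_def) (simp add: power2_eq_square)
  show ?thesis
    unfolding cinner_expand c_def[symmetric] n_def[symmetric] 1 2
    by (simp add: power_divide n_def)
qed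

lemma cinner_Cauchy_Schwarz: "cmod (cinner x y) \<le> norm x * norm (y :: 'a::chilbert_space)"
proof (cases "y = 0")
  case True
  have "cinner x (0 *\<^sub>C 0) = 0"
    unfolding cinner_scaleC_right by simp
  with True show ?thesis by simp
next
  case False
  have "0 \<le> (norm x)\<^sup>2 - (cmod (cinner x y) / norm y)\<^sup>2"
    unfolding norm_residual[OF False, symmetric] by (rule zero_le_power2)
  then have "cmod (cinner x y) / norm y \<le> norm x"
    by (auto intro: power2_le_imp_le)
  with False show ?thesis
    by (simp add: pos_divide_le_eq)
qed

interpretation cinner: bounded_bilinear "cinner :: 'a::chilbert_space \<Rightarrow> 'a \<Rightarrow> complex"
proof
  fix a a' b b' :: 'a and r :: real
  show "cinner (a + a') b = cinner a b + cinner a' b"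
    by (rule cinner_add_left)
  show "cinner a (b + b') = cinner a b + cinner a b'"
    by (metis cinner_add_left cinner_commute complex_cnj_add)
  show "cinner (r *\<^sub>R a) b = r *\<^sub>R cinner a b"
    unfolding scaleC_of_real[symmetric] cinner_scaleC_left by (rule scaleR_conv_of_real[symmetric])
  show "cinner a (r *\<^sub>R b) = r *\<^sub>R cinner a b"
    unfolding scaleC_of_real[symmetric] cinner_scaleC_right complex_cnj_complex_of_real
    by (rule scaleR_conv_of_real[symmetric])
  show "\<exists>K. \<forall>a b :: 'a. cmod (cinner a b) \<le> norm a * norm b * K"
    using cinner_Cauchy_Schwarz by (intro exI[of _ 1]) auto
qed

lemma bounded_linear_scaleC: "bounded_linear (\<lambda>x :: 'a::chilbert_space. a *\<^sub>C x)"
proof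
  show "a *\<^sub>C (x + y) = a *\<^sub>C x + a *\<^sub>C y" for x y :: 'a
    by (rule scaleC_add_right)
  show "a *\<^sub>C (r *\<^sub>R x) = r *\<^sub>R (a *\<^sub>C x)" for r and x :: 'a
    unfolding scaleC_of_real[symmetric] scaleC_scaleC by (simp add: mult.commute)
  show "\<exists>K. \<forall>x :: 'a. norm (a *\<^sub>C x) \<le> norm x * K"
    by (intro exI[of _ "cmod a"]) (simp add: norm_scaleC mult.commute)
qed

section \<open>Orthogonal projection onto closed subspaces\<close>

lemma parallelogram_law:
  fixes x y :: "'a::chilbert_space"
  shows "(norm (x + y))\<^sup>2 + (norm (x - y))\<^sup>2 = 2 * (norm x)\<^sup>2 + 2 * (norm y)\<^sup>2"
  using cinner_expand[of x 1 y] cinner_expand[of x "-1" y]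
  by (simp add: scaleC_one complex_vector.scale_minus_left)

lemma closest_point_exists:
  fixes x :: "'a::chilbert_space"
  assumes sub: "complex_vector.subspace M" and "closed M"
  obtains y where "y \<in> M" "\<And>m. m \<in> M \<Longrightarrow> norm (x - y) \<le> norm (x - m)"
proof -
  define d where "d = (INF m\<in>M. norm (x - m))"
  have ne: "M \<noteq> {}"
    using complex_vector.subspace_0[OF sub] by auto
  have bdd: "bdd_below ((\<lambda>m. norm (x - m)) ` M)"
    by (intro bdd_belowI2[of _ 0]) auto
  have d_le: "d \<le> norm (x - m)" if "m \<in> M" for m
    unfolding d_def using cINF_lower[OF bdd that] by simp
  have d0: "d \<ge> 0"
    unfolding d_def using ne by (intro cINF_greatest) auto
  have "\<exists>m\<in>M. norm (x - m) < d + 1 / real (Suc n)" for n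
    using cINF_less_iff[OF ne bdd, of "d + 1 / real (Suc n)"] by (auto simp: d_def)
  then obtain s where sM: "\<And>n. s n \<in> M" and s: "\<And>n. norm (x - s n) < d + 1 / real (Suc n)"
    by metis
  have lim: "(\<lambda>n. norm (x - s n)) \<longlonglongrightarrow> d"
  proof (rule tendsto_sandwich[of "\<lambda>_. d" _ _ "\<lambda>n. d + 1 / real (Suc n)"])
    show "(\<lambda>n. d + 1 / real (Suc n)) \<longlonglongrightarrow> d"
      using tendsto_add[OF tendsto_const LIMSEQ_inverse_real_of_nat, of d]
      by (simp add: inverse_eq_divide)
  qed (use d_le sM s in \<open>auto simp: less_imp_le\<close>)
  \<comment> \<open>The midpoint of \<open>s m\<close> and \<open>s n\<close> lies in
    \<open>M\<close>, hence at distance at least \<open>d\<close> from \<open>x\<close>; the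
    parallelogram law turns this into a bound on the gap.\<close>
  have gap: "(norm (s m - s n))\<^sup>2 \<le> 2 * (norm (x - s m))\<^sup>2 + 2 * (norm (x - s n))\<^sup>2 - 4 * d\<^sup>2" for m n
  proof -
    have "(1/2) *\<^sub>C (s m + s n) \<in> M"
      using sM sub by (intro complex_vector.subspace_scale complex_vector.subspace_add)
    moreover have "(1/2) *\<^sub>C (s m + s n) = (1/2) *\<^sub>R (s m + s n)"
      using scaleC_of_real[of "1/2"] by simp
    ultimately have "d \<le> norm (x - (1/2) *\<^sub>R (s m + s n))"
      using d_le by simp
    moreover have "(x - s m) + (x - s n) = 2 *\<^sub>R (x - (1/2) *\<^sub>R (s m + s n))"
      by (simp add: algebra_simps scaleR_2)
    ultimately have "2 * d \<le> norm ((x - s m) + (x - s n))"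
      by simp
    then have "(2 * d)\<^sup>2 \<le> (norm ((x - s m) + (x - s n)))\<^sup>2"
      using d0 by (intro power_mono) auto
    then show ?thesis
      using parallelogram_law[of "x - s m" "x - s n"]
      by (simp add: norm_minus_commute power_mult_distrib)
  qed
  have "Cauchy s"
  proof (rule metric_CauchyI)
    fix e :: real assume "e > 0"
    have "(\<lambda>n. (norm (x - s n))\<^sup>2) \<longlonglongrightarrow> d\<^sup>2"
      using lim by (rule tendsto_power)
    moreover have "d\<^sup>2 < d\<^sup>2 + e\<^sup>2 / 4"
      using \<open>e > 0\<close> by simp
    ultimately have "\<forall>\<^sub>F n in sequentially. (norm (x - s n))\<^sup>2 < d\<^sup>2 + e\<^sup>2 / 4"
      by (rule order_tendstoD)
    then obtain N where N: "\<And>n. n \<ge> N \<Longrightarrow> (norm (x - s n))\<^sup>2 < d\<^sup>2 + e\<^sup>2 / 4"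
      by (auto simp: eventually_sequentially)
    have "norm (s m - s n) < e" if "m \<ge> N" "n \<ge> N" for m n
    proof -
      have "(norm (s m - s n))\<^sup>2 < e\<^sup>2"
        using gap[of m n] N[OF that(1)] N[OF that(2)] by simp
      then show ?thesis
        using \<open>e > 0\<close> by (simp add: power2_less_imp_less)
    qed
    then show "\<exists>N. \<forall>m\<ge>N. \<forall>n\<ge>N. dist (s m) (s n) < e"
      by (auto simp: dist_norm)
  qed
  then obtain y where y: "s \<longlonglongrightarrow> y"
    by (auto simp: Cauchy_convergent_iff convergent_def)
  have "norm (x - y) = d"
    using lim tendsto_norm[OF tendsto_diff[OF tendsto_const y]] by (rule LIMSEQ_unique[symmetric])
  moreover have "y \<in> M"
    using \<open>closed M\<close> sM y closed_sequentially by blast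
  ultimately show ?thesis
    using d_le that by blast
qed

lemma orth_decomposition:
  fixes x :: "'a::chilbert_space"
  assumes sub: "complex_vector.subspace M" and "closed M"
  obtains y where "y \<in> M" "x - y \<in> orth_compl M"
proof -
  obtain y where y: "y \<in> M" and min: "\<And>m. m \<in> M \<Longrightarrow> norm (x - y) \<le> norm (x - m)"
    using closest_point_exists[OF assms, of x] by blast
  have "cinner (x - y) v = 0" if v: "v \<in> M" for v
  proof (cases "v = 0")
    case False
    \<comment> \<open>The optimal step along \<open>v\<close>: unless the inner product vanishes, it
      would bring \<open>y\<close> strictly closer to \<open>x\<close>.\<close>
    define a where "a = - cinner (x - y) v / (norm v)\<^sup>2"
    have "y - a *\<^sub>C v \<in> M"
      using y v sub complex_vector.subspace_diff complex_vector.subspace_scale by blast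
    from min[OF this] have "norm (x - y) \<le> norm ((x - y) + a *\<^sub>C v)"
      by (simp add: algebra_simps)
    then have "(norm (x - y))\<^sup>2 \<le> (norm ((x - y) + a *\<^sub>C v))\<^sup>2"
      by (intro power_mono) auto
    then show ?thesis
      using False unfolding a_def norm_residual[OF False] by simp
  qed (simp add: cinner.zero_right)
  then show ?thesis
    using y that by (auto simp: orth_compl_def)
qed

lemma orth_compl_trivial_imp_UNIV:
  fixes M :: "'a::chilbert_space set"
  assumes "complex_vector.subspace M" "closed M" "orth_compl M \<subseteq> {0}"
  shows "M = UNIV"
proof -
  have "x \<in> M" for x
    using orth_decomposition[OF assms(1,2), of x] assms(3) by (metis eq_iff_diff_eq_0 singletonD subsetD)
  then show ?thesis by auto
qed

section \<open>Self-adjoint operators\<close>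

lemma mem_adj_iff: "(u, v) \<in> adj A \<longleftrightarrow> (\<forall>(f, g) \<in> A. cinner g u = cinner f v)"
  by (simp add: adjoint_in_def)

lemma adjD: "(u, v) \<in> adj A \<Longrightarrow> (f, g) \<in> A \<Longrightarrow> cinner g u = cinner f v"
  by (auto simp: mem_adj_iff)

lemma adj_antimono: "A \<subseteq> B \<Longrightarrow> adj B \<subseteq> adj A"
  by (auto simp: adjoint_in_def)

lemma adj_add: "(f, g) \<in> adj A \<Longrightarrow> (f', g') \<in> adj A \<Longrightarrow> (f + f', g + g') \<in> adj A"
  by (simp add: mem_adj_iff cinner.add_right case_prod_beta)

lemma adj_scale: "(f, g) \<in> adj A \<Longrightarrow> (c *\<^sub>C f, c *\<^sub>C g) \<in> adj A"
  by (simp add: mem_adj_iff cinner_scaleC_right case_prod_beta)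

lemma adj_diff: "(f, g) \<in> adj A \<Longrightarrow> (f', g') \<in> adj A \<Longrightarrow> (f - f', g - g') \<in> adj A"
  by (simp add: mem_adj_iff cinner.diff_right case_prod_beta)

lemma adj_zero: "(0, 0) \<in> adj A"
  by (auto simp: mem_adj_iff cinner.zero_right)

text \<open>Graphs of adjoints are closed because the pairing is continuous. With
  \<open>adj Q = Q\<close> this yields closedness of self-adjoint operators.\<close>

lemma adj_limit:
  assumes "\<And>n. (f n, g n) \<in> adj A" "f \<longlonglongrightarrow> f'" "g \<longlonglongrightarrow> g'"
  shows "(f', g') \<in> adj A"
  unfolding mem_adj_iff
proof clarify
  fix u v assume "(u, v) \<in> A"
  then have "cinner v (f n) = cinner u (g n)" for n
    using assms(1) adjD by blast
  then have "(\<lambda>n. cinner v (f n)) \<longlonglongrightarrow> cinner u g'"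
    using cinner.tendsto[OF tendsto_const assms(3)] by simp
  with cinner.tendsto[OF tendsto_const assms(2)] show "cinner v f' = cinner u g'"
    by (rule LIMSEQ_unique)
qed

lemma orth_dense_eq_0:
  assumes "closure D = UNIV" "\<And>f. f \<in> D \<Longrightarrow> cinner f v = 0"
  shows "v = (0 :: 'a::chilbert_space)"
proof -
  have "cinner v v = 0"
  proof (rule continuous_constant_on_closure[of D "\<lambda>f. cinner f v" 0 v])
    show "continuous_on (closure D) (\<lambda>f. cinner f v)"
      by (intro cinner.continuous_on continuous_on_id continuous_on_const)
  qed (use assms in auto)
  then show ?thesis
    by (simp add: cinner_self)
qed

text \<open>Used throughout to identify values: a vector in the domain of an operator contained in
  \<open>adj A\<close> has the value already computed in \<open>adj A\<close>.\<close>

lemma adj_single_valued: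
  assumes "densely_defined A" "(f, g) \<in> adj A" "(f, g') \<in> adj A"
  shows "g = g'"
proof -
  have "cinner u (g - g') = 0" if u: "u \<in> Domain A" for u
  proof -
    obtain v where "(u, v) \<in> A" using u by blast
    then show ?thesis
      using adjD[OF assms(2)] adjD[OF assms(3)] by (metis cinner.diff_right diff_self)
  qed
  then have "g - g' = 0"
    using assms(1) by (intro orth_dense_eq_0) (auto simp: densely_defined_def)
  then show ?thesis by simp
qed

section \<open>The resolvent of a self-adjoint operator\<close>

locale selfadjoint_operator =
  fixes Q :: "'a::chilbert_space operator"
  assumes sa: "selfadjoint Q"
begin

lemma adj_Q: "adj Q = Q"
  using sa by (simp add: selfadjoint_in_def)

lemma dense_Domain: "closure (Domain Q) = UNIV"
  using sa by (auto simp: selfadjoint_in_def)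

lemma Q_add: "(f, g) \<in> Q \<Longrightarrow> (f', g') \<in> Q \<Longrightarrow> (f + f', g + g') \<in> Q"
  using adj_add[of f g Q] by (simp add: adj_Q)

lemma Q_diff: "(f, g) \<in> Q \<Longrightarrow> (f', g') \<in> Q \<Longrightarrow> (f - f', g - g') \<in> Q"
  using adj_diff[of f g Q] by (simp add: adj_Q)

lemma Q_scale: "(f, g) \<in> Q \<Longrightarrow> (c *\<^sub>C f, c *\<^sub>C g) \<in> Q"
  using adj_scale[of f g Q] by (simp add: adj_Q)

lemma Q_sym: "(f, g) \<in> Q \<Longrightarrow> (f', g') \<in> Q \<Longrightarrow> cinner g f' = cinner f g'"
  using adjD[of f' g' Q f g] by (simp add: adj_Q)

lemma Q_real: "(f, g) \<in> Q \<Longrightarrow> Im (cinner g f) = 0"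
  by (metis Q_sym cinner_commute cnj.simps(2) neg_equal_zero)

text \<open>Paired with \<open>f\<close>, the part coming from \<open>Q\<close> is real, so the
  imaginary part of the pairing is - Im z times the squared norm of \<open>f\<close>; Cauchy-Schwarz
  finishes.\<close>

lemma resolvent_lower_bound:
  assumes "(f, g) \<in> Q"
  shows "\<bar>Im z\<bar> * norm f \<le> norm (g - z *\<^sub>C f)"
proof (cases "f = 0")
  case False
  have "Im (cinner (g - z *\<^sub>C f) f) = - (Im z * (norm f)\<^sup>2)"
    using Q_real[OF assms] by (simp add: cinner.diff_left cinner_scaleC_left cinner_self)
  then have "\<bar>Im z\<bar> * (norm f)\<^sup>2 \<le> cmod (cinner (g - z *\<^sub>C f) f)"
    using abs_Im_le_cmod[of "cinner (g - z *\<^sub>C f) f"] by (simp add: abs_mult)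
  also have "\<dots> \<le> norm (g - z *\<^sub>C f) * norm f"
    by (rule cinner_Cauchy_Schwarz)
  finally show ?thesis
    using False by (simp add: power2_eq_square)
qed auto

lemma eigenvector_eq_0:
  assumes "(f, z *\<^sub>C f) \<in> Q" "Im z \<noteq> 0"
  shows "f = 0"
  using resolvent_lower_bound[OF assms(1), of z] assms(2) by (simp add: mult_le_0_iff)

text \<open>The range \<open>S\<close> of Q - z is closed by the lower bound, and a vector
  orthogonal to it is an eigenvector of \<open>Q\<close> for the nonreal number
  \<open>cnj z\<close>, hence zero.\<close>

lemma resolvent_exists:
  assumes z: "Im z \<noteq> 0"
  shows "\<exists>r. (r, h + z *\<^sub>C r) \<in> Q"
proof -
  define S where "S = {g - z *\<^sub>C f | f g. (f, g) \<in> Q}"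
  have "complex_vector.subspace S"
  proof (rule complex_vector.subspaceI)
    show "0 \<in> S"
      using adj_zero[of Q] unfolding S_def adj_Q by (auto intro!: exI[of _ 0])
    fix x y c assume x: "x \<in> S"
    then obtain f g where fg: "(f, g) \<in> Q" "x = g - z *\<^sub>C f"
      by (auto simp: S_def)
    have "c *\<^sub>C x = c *\<^sub>C g - z *\<^sub>C c *\<^sub>C f"
      by (simp add: fg complex_vector.scale_right_diff_distrib complex_vector.scale_left_commute)
    then show "c *\<^sub>C x \<in> S"
      using Q_scale[OF fg(1), of c] unfolding S_def by blast
    assume "y \<in> S"
    then obtain f' g' where fg': "(f', g') \<in> Q" "y = g' - z *\<^sub>C f'"
      by (auto simp: S_def)
    have "x + y = (g + g') - z *\<^sub>C (f + f')"
      by (simp add: fg fg' scaleC_add_right)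
    then show "x + y \<in> S"
      using Q_add[OF fg(1) fg'(1)] unfolding S_def by blast
  qed
  moreover have "closed S"
    unfolding closed_sequential_limits
  proof (intro allI impI, elim conjE)
    fix s l assume "\<forall>n. s n \<in> S" and s: "s \<longlonglongrightarrow> l"
    then have "\<forall>n. \<exists>f g. (f, g) \<in> Q \<and> s n = g - z *\<^sub>C f"
      unfolding S_def mem_Collect_eq by metis
    then obtain f g where Q: "\<And>n. (f n, g n) \<in> Q" and s_eq: "\<And>n. s n = g n - z *\<^sub>C f n"
      by metis
    have "Cauchy f"
    proof (rule metric_CauchyI)
      fix e :: real assume "e > 0"
      with z have "e * \<bar>Im z\<bar> > 0" by simp
      then obtain N where N: "\<And>m n. m \<ge> N \<Longrightarrow> n \<ge> N \<Longrightarrow> dist (s m) (s n) < e * \<bar>Im z\<bar>"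
        using metric_CauchyD[OF LIMSEQ_imp_Cauchy[OF s]] by blast
      have "dist (f m) (f n) < e" if "m \<ge> N" "n \<ge> N" for m n
      proof -
        have "s m - s n = (g m - g n) - z *\<^sub>C (f m - f n)"
          by (simp add: s_eq complex_vector.scale_right_diff_distrib)
        then have "\<bar>Im z\<bar> * norm (f m - f n) \<le> norm (s m - s n)"
          using resolvent_lower_bound[OF Q_diff[OF Q Q], of z m n] by simp
        also have "\<dots> < \<bar>Im z\<bar> * e"
          using N[OF that] by (simp add: dist_norm mult.commute)
        finally show ?thesis
          using z by (simp add: dist_norm)
      qed
      then show "\<exists>N. \<forall>m\<ge>N. \<forall>n\<ge>N. dist (f m) (f n) < e" by blast
    qed
    then obtain f' where f': "f \<longlonglongrightarrow> f'"
      by (auto simp: Cauchy_convergent_iff convergent_def)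
    have "(\<lambda>n. s n + z *\<^sub>C f n) \<longlonglongrightarrow> l + z *\<^sub>C f'"
      by (intro tendsto_add s bounded_linear.tendsto[OF bounded_linear_scaleC] f')
    then have "g \<longlonglongrightarrow> l + z *\<^sub>C f'"
      by (simp add: s_eq)
    then have "(f', l + z *\<^sub>C f') \<in> Q"
      using adj_limit[of f g Q] Q f' by (simp add: adj_Q)
    then show "l \<in> S"
      unfolding S_def by (metis (mono_tags, lifting) add_diff_cancel_right' mem_Collect_eq)
  qed
  moreover have "orth_compl S \<subseteq> {0}"
  proof
    fix e assume "e \<in> orth_compl S"
    then have "cinner e (g - z *\<^sub>C f) = 0" if "(f, g) \<in> Q" for f g
      using that by (auto simp: orth_compl_def S_def)
    moreover have "cinner (g - z *\<^sub>C f) e = cinner g e - cinner f (cnj z *\<^sub>C e)" for f g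
      by (simp add: cinner.diff_left cinner_scaleC_left cinner_scaleC_right)
    ultimately have "cinner g e = cinner f (cnj z *\<^sub>C e)" if "(f, g) \<in> Q" for f g
      using that cinner_commute[of "g - z *\<^sub>C f" e] by simp
    then have "(e, cnj z *\<^sub>C e) \<in> adj Q"
      by (auto simp: mem_adj_iff)
    then show "e \<in> {0}"
      using eigenvector_eq_0[of e "cnj z"] z by (simp add: adj_Q)
  qed
  ultimately have "h \<in> S"
    using orth_compl_trivial_imp_UNIV[of S] by simp
  then obtain f g where "(f, g) \<in> Q" "h = g - z *\<^sub>C f"
    unfolding S_def by blast
  then show ?thesis
    by (intro exI[of _ f]) simp
qed

lemma resolvent_unique:
  assumes "Im z \<noteq> 0" "(r, h + z *\<^sub>C r) \<in> Q" "(r', h + z *\<^sub>C r') \<in> Q"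
  shows "r = r'"
  using eigenvector_eq_0[of "r - r'" z] Q_diff[OF assms(2,3)] assms(1)
  by (simp add: complex_vector.scale_right_diff_distrib)

text \<open>This is (Q - z)^-1 h in graph form: the vector r with Q r = h + z r, which avoids
  subtracting operators.\<close>

definition resolvent :: "complex \<Rightarrow> 'a \<Rightarrow> 'a" where
  "resolvent z h = (SOME r. (r, h + z *\<^sub>C r) \<in> Q)"

lemma resolvent: "Im z \<noteq> 0 \<Longrightarrow> (resolvent z h, h + z *\<^sub>C resolvent z h) \<in> Q"
  unfolding resolvent_def by (rule someI_ex) (rule resolvent_exists)

lemma resolvent_eq: "Im z \<noteq> 0 \<Longrightarrow> (r, h + z *\<^sub>C r) \<in> Q \<Longrightarrow> resolvent z h = r"
  using resolvent_unique[OF _ resolvent] by simp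

lemma norm_resolvent_le:
  assumes "Im z \<noteq> 0"
  shows "\<bar>Im z\<bar> * norm (resolvent z h) \<le> norm h"
  using resolvent_lower_bound[OF resolvent[OF assms], of z h] by simp

end

section \<open>The trigonometric moment problem for isometries\<close>

text \<open>Orthogonality of the exponentials. The period is cut out by an indicator, so that the
  Fejer densities can be measures on the whole line; \<open>j\<close> is an integer because it will
  be a difference of indices.\<close>

lemma has_bochner_integral_iexp_period:
  fixes j :: int
  shows "has_bochner_integral lborel (\<lambda>x. indicator {0..2 * pi} x *\<^sub>R iexp (real_of_int j * x))
    (if j = 0 then complex_of_real (2 * pi) else 0)"
proof -
  define F where "F x = (if j = 0 then complex_of_real x else iexp (real_of_int j * x) / (\<i> * j))" for x :: real
  have F: "(F has_vector_derivative iexp (real_of_int j * x)) (at x within {0..2 * pi})" for x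
  proof (cases "j = 0")
    case True
    have "((\<lambda>x. complex_of_real x) has_vector_derivative of_real 1) (at x within {0..2 * pi})"
      by (intro has_vector_derivative_of_real DERIV_ident)
    with True show ?thesis
      by (simp add: F_def[abs_def])
  next
    case False
    have "((\<lambda>z. exp (\<i> * (j * z)) / (\<i> * j)) has_field_derivative exp (\<i> * (j * complex_of_real x)))
        (at (complex_of_real x))"
      using False by (auto intro!: derivative_eq_intros simp: field_simps)
    then show ?thesis
      using False has_vector_derivative_real_field[of _ _ x "{0..2 * pi}"] by (simp add: F_def[abs_def])
  qed
  have "F (2 * pi) - F 0 = (if j = 0 then complex_of_real (2 * pi) else 0)"
  proof -
    have "exp (\<i> * (of_int j * (2 * complex_of_real pi))) = 1"
      using exp_integer_2pi[of "of_int j"] by (simp add: mult_ac)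
    then show ?thesis
      by (simp add: F_def)
  qed
  moreover have "continuous_on {0..2 * pi} (\<lambda>x. iexp (real_of_int j * x))"
    by (intro continuous_intros)
  ultimately show ?thesis
    using has_bochner_integral_FTC_Icc[of 0 "2 * pi" F "\<lambda>x. iexp (real_of_int j * x)"] F by simp
qed

locale hilbert_isometry =
  fixes U :: "'a::chilbert_space \<Rightarrow> 'a" and g :: 'a
  assumes isometry: "cinner (U x) (U y) = cinner x y"
    and unit: "norm g = 1"
begin

abbreviation moment :: "nat \<Rightarrow> complex" where
  "moment k \<equiv> cinner ((U ^^ k) g) g"

text \<open>The Gram matrix of the iterates is Toeplitz, which is what lets a sequence of moments
  describe it.\<close>

lemma cinner_iterates: "cinner ((U ^^ (n + k)) g) ((U ^^ n) g) = moment k"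
  by (induction n) (simp_all add: isometry)

lemma norm_iterate: "norm ((U ^^ k) x) = norm x"
proof (induction k)
  case (Suc k)
  have "complex_of_real ((norm ((U ^^ Suc k) x))\<^sup>2) = complex_of_real ((norm ((U ^^ k) x))\<^sup>2)"
    unfolding cinner_self[symmetric] by (simp add: isometry)
  then have "(norm ((U ^^ Suc k) x))\<^sup>2 = (norm ((U ^^ k) x))\<^sup>2"
    using of_real_eq_iff by blast
  with Suc show ?case
    by (simp add: power2_eq_iff_nonneg)
qed simp

lemma cmod_moment_le: "cmod (moment k) \<le> 1"
  using cinner_Cauchy_Schwarz[of "(U ^^ k) g" g] by (simp add: norm_iterate unit)

text \<open>The Fejer mean of the Fourier series whose coefficients are the moments. Writing it as a
  squared norm makes it visibly nonnegative.\<close>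

definition fejer_density :: "nat \<Rightarrow> real \<Rightarrow> real" where
  "fejer_density N x = indicator {0..2 * pi} x *
    (norm (\<Sum>n<N. iexp (- (real n * x)) *\<^sub>C (U ^^ n) g))\<^sup>2 / (2 * pi * N)"

lemma fejer_density_nonneg: "0 \<le> fejer_density N x"
  by (simp add: fejer_density_def)

text \<open>Expanding the square leaves only the pairs with m = n + k. There are N - k of them, each
  contributing the same moment, whence the Fejer weight 1 - k/N.\<close>

lemma has_bochner_integral_fejer_density:
  assumes "k \<le> N" "N > 0"
  shows "has_bochner_integral lborel (\<lambda>x. fejer_density N x *\<^sub>R iexp (real k * x))
    (complex_of_real (real (N - k) / real N) * moment k)"
proof -
  define u where "u n = (U ^^ n) g" for n
  define I where "I m n = (if int k - int m + int n = 0 then complex_of_real (2 * pi) else 0)" for m n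
  have sq: "complex_of_real ((norm (\<Sum>n<N. iexp (- (real n * x)) *\<^sub>C u n))\<^sup>2) * iexp (real k * x)
      = (\<Sum>m<N. \<Sum>n<N. cinner (u m) (u n) * iexp (real_of_int (int k - int m + int n) * x))" for x
  proof -
    have "complex_of_real ((norm (\<Sum>n<N. iexp (- (real n * x)) *\<^sub>C u n))\<^sup>2) * iexp (real k * x)
        = (\<Sum>m<N. \<Sum>n<N. iexp (- (real m * x)) * (cnj (iexp (- (real n * x))) * cinner (u m) (u n))) * iexp (real k * x)"
      unfolding cinner_self[symmetric] cinner.sum_left
      unfolding cinner.sum_right
      by (simp add: cinner_scaleC_left cinner_scaleC_right mult.left_commute)
    also have "\<dots> = (\<Sum>m<N. \<Sum>n<N. cinner (u m) (u n) * iexp (real_of_int (int k - int m + int n) * x))"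
      unfolding sum_distrib_right
    proof (intro sum.cong refl)
      fix m n
      have "iexp (real_of_int (int k - int m + int n) * x) = iexp (- (real m * x)) * iexp (real n * x) * iexp (real k * x)"
        unfolding exp_add[symmetric] by (rule arg_cong[of _ _ exp]) (simp add: algebra_simps)
      then show "iexp (- (real m * x)) * (cnj (iexp (- (real n * x))) * cinner (u m) (u n)) * iexp (real k * x)
          = cinner (u m) (u n) * iexp (real_of_int (int k - int m + int n) * x)"
        by (simp add: exp_cnj)
    qed
    finally show ?thesis .
  qed
  have "has_bochner_integral lborel
      (\<lambda>x. (\<Sum>m<N. \<Sum>n<N. cinner (u m) (u n) *
          (indicator {0..2 * pi} x *\<^sub>R iexp (real_of_int (int k - int m + int n) * x))) / (2 * pi * N))
      ((\<Sum>m<N. \<Sum>n<N. cinner (u m) (u n) * I m n) / (2 * pi * N))"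
    unfolding I_def
    by (intro has_bochner_integral_divide_zero has_bochner_integral_sum has_bochner_integral_mult_right
        has_bochner_integral_iexp_period)
  moreover have "(\<Sum>m<N. \<Sum>n<N. cinner (u m) (u n) *
      (indicator {0..2 * pi} x *\<^sub>R iexp (real_of_int (int k - int m + int n) * x))) / (2 * pi * N)
      = fejer_density N x *\<^sub>R iexp (real k * x)" for x
  proof -
    have "(\<Sum>m<N. \<Sum>n<N. cinner (u m) (u n) *
        (indicator {0..2 * pi} x *\<^sub>R iexp (real_of_int (int k - int m + int n) * x)))
      = complex_of_real (indicator {0..2 * pi} x) *
        (\<Sum>m<N. \<Sum>n<N. cinner (u m) (u n) * iexp (real_of_int (int k - int m + int n) * x))"
      unfolding sum_distrib_left
      by (intro sum.cong refl) (simp add: scaleR_conv_of_real del: of_int_diff of_int_add)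
    note this [unfolded sq[symmetric]]
    then show ?thesis
      unfolding fejer_density_def u_def
      by (simp add: scaleR_conv_of_real)
  qed
  moreover have "(\<Sum>m<N. \<Sum>n<N. cinner (u m) (u n) * I m n) / (2 * pi * N)
      = complex_of_real (real (N - k) / real N) * moment k"
  proof -
    \<comment> \<open>After the swap, each \<open>n\<close> has a single matching index m = n + k,
      and it is below \<open>N\<close> exactly when n < N - k.\<close>
    have "(\<Sum>m<N. \<Sum>n<N. cinner (u m) (u n) * I m n) = (\<Sum>n<N. \<Sum>m<N. cinner (u m) (u n) * I m n)"
      by (rule sum.swap)
    also have "\<dots> = (\<Sum>n<N. if n < N - k then 2 * pi * moment k else 0)"
    proof (intro sum.cong refl)
      fix n
      have "(\<Sum>m<N. cinner (u m) (u n) * I m n)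
          = (\<Sum>m<N. if m = n + k then cinner (u m) (u n) * (2 * pi) else 0)"
        by (intro sum.cong refl) (auto simp: I_def)
      also have "\<dots> = (if n < N - k then 2 * pi * moment k else 0)"
        by (auto simp: u_def cinner_iterates less_diff_conv)
      finally show "(\<Sum>m<N. cinner (u m) (u n) * I m n) = (if n < N - k then 2 * pi * moment k else 0)" .
    qed
    also have "\<dots> = (\<Sum>n<N-k. 2 * pi * moment k)"
      by (intro sum.mono_neutral_cong_right) auto
    finally show ?thesis
      using assms(2) by simp
  qed
  ultimately show ?thesis by simp
qed

definition fejer_measure :: "nat \<Rightarrow> real measure" where
  "fejer_measure N = density lborel (\<lambda>x. ennreal (fejer_density N x))"

lemma fejer_density_measurable [measurable]: "fejer_density N \<in> borel_measurable borel"
proof -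
  have "continuous_on UNIV (\<lambda>x. (norm (\<Sum>n<N. iexp (- (real n * x)) *\<^sub>C (U ^^ n) g))\<^sup>2)"
  proof -
    have "bounded_linear (\<lambda>a. a *\<^sub>C (v :: 'a))" for v
    proof
      show "(a + b) *\<^sub>C v = a *\<^sub>C v + b *\<^sub>C v" for a b
        by (rule scaleC_add_left)
      show "(r *\<^sub>R b) *\<^sub>C v = r *\<^sub>R (b *\<^sub>C v)" for r b
        by (simp add: scaleR_conv_of_real flip: scaleC_of_real scaleC_scaleC)
      show "\<exists>K. \<forall>x. norm (x *\<^sub>C v) \<le> cmod x * K"
        by (intro exI[of _ "norm v"]) (simp add: norm_scaleC)
    qed
    note bounded_linear.continuous_on[OF this, continuous_intros]
    show ?thesis
      by (intro continuous_intros)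
  qed
  then have [measurable]: "(\<lambda>x. (norm (\<Sum>n<N. iexp (- (real n * x)) *\<^sub>C (U ^^ n) g))\<^sup>2) \<in> borel_measurable borel"
    by (rule borel_measurable_continuous_onI)
  show ?thesis
    unfolding fejer_density_def[abs_def] by measurable
qed

lemma char_fejer_measure:
  assumes "k \<le> N" "N > 0"
  shows "char (fejer_measure N) k = complex_of_real (real (N - k) / real N) * moment k"
proof -
  have "char (fejer_measure N) k = (CLINT x|lborel. fejer_density N x *\<^sub>R iexp (real k * x))"
    unfolding char_def fejer_measure_def
    by (intro integral_density) (auto simp: fejer_density_nonneg)
  then show ?thesis
    using has_bochner_integral_fejer_density[OF assms] by (simp add: has_bochner_integral_iff)
qed

lemma real_distribution_fejer_measure:
  assumes "N > 0"
  shows "real_distribution (fejer_measure N)"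
proof -
  have "has_bochner_integral lborel (\<lambda>x. complex_of_real (fejer_density N x)) 1"
    using has_bochner_integral_fejer_density[of 0 N] assms
    by (simp add: cinner_self unit scaleR_conv_of_real)
  then have "has_bochner_integral lborel (fejer_density N) 1"
    using has_bochner_integral_Re by fastforce
  then have "integrable lborel (fejer_density N)" "integral\<^sup>L lborel (fejer_density N) = 1"
    by (auto simp: has_bochner_integral_iff)
  then have "emeasure (fejer_measure N) UNIV = 1"
    by (simp add: fejer_measure_def emeasure_density nn_integral_eq_integral fejer_density_nonneg)
  then have "prob_space (fejer_measure N)"
    by (intro prob_spaceI) (simp add: fejer_measure_def)
  then show ?thesis
    by (simp add: real_distribution_def real_distribution_axioms_def fejer_measure_def)
qed

text \<open>Tightness is stated with half-open intervals; starting at -1 keeps the left end 0 of the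
  period inside.\<close>

lemma fejer_measure_period:
  assumes "N > 0"
  shows "measure (fejer_measure N) {-1<..2 * pi} = 1"
proof -
  interpret real_distribution "fejer_measure N"
    by (rule real_distribution_fejer_measure[OF assms])
  have "emeasure (fejer_measure N) (- {-1<..2 * pi}) =
      (\<integral>\<^sup>+x. ennreal (fejer_density N x) * indicator (- {-1<..2 * pi}) x \<partial>lborel)"
    by (simp add: fejer_measure_def emeasure_density)
  also have "\<dots> = (\<integral>\<^sup>+x. 0 \<partial>(lborel :: real measure))"
    by (intro nn_integral_cong) (auto simp: fejer_density_def split: split_indicator)
  finally have "prob (- {-1<..2 * pi}) = 0"
    by (simp add: measure_def)
  then show ?thesis
    using prob_compl[of "{-1<..2 * pi}"] by (simp add: Compl_eq_Diff_UNIV)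
qed

text \<open>All Fejer measures live on one compact interval, so a subsequence converges weakly. Weak
  limits preserve characteristic functions, and the Fejer weights tend to 1.\<close>

theorem moment_measure:
  obtains \<rho> where "real_distribution \<rho>" "\<And>k. char \<rho> (real k) = moment k"
proof -
  have dist: "real_distribution (fejer_measure (Suc n))" for n
    by (rule real_distribution_fejer_measure) simp
  have "tight (\<lambda>n. fejer_measure (Suc n))"
    unfolding tight_def using dist
  proof (intro conjI allI impI)
    fix \<epsilon> :: real assume "\<epsilon> > 0"
    then show "\<exists>a b. a < b \<and> (\<forall>n. 1 - \<epsilon> < measure (fejer_measure (Suc n)) {a<..b})"
      by (intro exI[of _ "-1"] exI[of _ "2 * pi"]) (auto simp: fejer_measure_period intro: less_trans[of _ 0])
  qed auto
  from tight_imp_convergent_subsubsequence[OF this strict_mono_id]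
  obtain r \<rho> where r: "strict_mono r" and \<rho>: "real_distribution \<rho>"
    and conv: "weak_conv_m ((\<lambda>n. fejer_measure (Suc n)) \<circ> id \<circ> r) \<rho>"
    by blast
  have "char \<rho> (real k) = moment k" for k
  proof (rule LIMSEQ_unique)
    show "(\<lambda>n. char (fejer_measure (Suc (r n))) k) \<longlonglongrightarrow> char \<rho> k"
      using levy_continuity1[OF _ \<rho> conv] dist by simp
    have "(\<lambda>n. (1 - real k / real (Suc n)) * 1) \<longlonglongrightarrow> (1 - 0) * 1"
      by real_asymp
    then have "(\<lambda>n. 1 - real k / real (Suc (r n))) \<longlonglongrightarrow> 1"
      using LIMSEQ_subseq_LIMSEQ[OF _ r] by (force simp: o_def)
    from tendsto_mult[OF tendsto_of_real[OF this] tendsto_const[of "moment k"]]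
    have "(\<lambda>n. complex_of_real (1 - real k / real (Suc (r n))) * moment k) \<longlonglongrightarrow> moment k"
      by (simp only: of_real_1 mult_1_left)
    \<comment> \<open>The coefficient formula covers only k at most N, so equality is claimed
      eventually.\<close>
    moreover have "\<forall>\<^sub>F n in sequentially. complex_of_real (1 - real k / real (Suc (r n))) * moment k
        = char (fejer_measure (Suc (r n))) k"
    proof (rule eventually_sequentiallyI[of k])
      fix n assume "n \<ge> k"
      with seq_suble[OF r, of n] have "k \<le> Suc (r n)" by simp
      then show "complex_of_real (1 - real k / real (Suc (r n))) * moment k
          = char (fejer_measure (Suc (r n))) k"
        by (subst char_fejer_measure) (simp_all add: of_nat_diff diff_divide_distrib del: of_nat_Suc)
    qed
    ultimately show "(\<lambda>n. char (fejer_measure (Suc (r n))) k) \<longlonglongrightarrow> moment k"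
      by (rule Lim_transform_eventually)
  qed
  with \<rho> that show ?thesis by blast
qed

end

section \<open>The Nevanlinna function of a self-adjoint operator\<close>

lemma Im_plus_i_nonzero: "Im z > 0 \<Longrightarrow> z + \<i> \<noteq> 0"
  by (auto simp: complex_eq_iff)

text \<open>The Cayley map from the upper half-plane to the unit disc, taking i to 0.\<close>

definition disc_coord :: "complex \<Rightarrow> complex" where
  "disc_coord z = (z - \<i>) / (z + \<i>)"

lemma cmod_disc_coord_less:
  assumes "Im z > 0"
  shows "cmod (disc_coord z) < 1"
proof -
  have "(cmod (z - \<i>))\<^sup>2 < (cmod (z + \<i>))\<^sup>2"
    unfolding cmod_power2 using assms by (simp add: power2_eq_square algebra_simps)
  then have "cmod (z - \<i>) < cmod (z + \<i>)"
    by (rule power2_less_imp_less) simp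
  then show ?thesis
    by (simp add: disc_coord_def norm_divide divide_less_eq)
qed

text \<open>With x = cot (\<theta>/2) the circle point is (x + i) / (x - i), so the Herglotz kernel
  i (1 + w e) / (1 - w e) of the disc becomes the Nevanlinna kernel of the half-plane.\<close>

lemma cot_Moebius:
  fixes \<theta> :: real
  assumes "sin (\<theta> / 2) \<noteq> 0" and z: "Im z > 0"
  defines "x \<equiv> complex_of_real (cot (\<theta> / 2))"
  shows "\<i> * (2 / (1 - disc_coord z * iexp \<theta>) - 1) = (1 + x * z) / (x - z)"
proof -
  define c s where "c = complex_of_real (cos (\<theta> / 2))" and "s = complex_of_real (sin (\<theta> / 2))"
  have s: "s \<noteq> 0" and x: "x = c / s"
    using assms(1) by (auto simp: c_def s_def x_def cot_def)
  have xz: "x - z \<noteq> 0"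
    using z by (auto simp: x_def complex_eq_iff)
  have xi: "x - \<i> \<noteq> 0"
    by (auto simp: x_def complex_eq_iff)
  have zi: "z + \<i> \<noteq> 0"
    using z by (rule Im_plus_i_nonzero)
  \<comment> \<open>Half angles are used because dividing c + i s and c - i s by s gives x + i and x
    - i.\<close>
  have half: "iexp (\<theta> / 2) = c + \<i> * s" "iexp (- (\<theta> / 2)) = c - \<i> * s"
    unfolding cis_conv_exp[symmetric] by (simp_all add: c_def s_def complex_eq_iff)
  have "iexp \<theta> * iexp (- (\<theta> / 2)) = iexp (\<theta> / 2)"
    unfolding exp_add[symmetric] by (rule arg_cong[of _ _ exp]) (simp add: field_simps)
  then have "iexp \<theta> * (c - \<i> * s) = c + \<i> * s"
    unfolding half .
  then have "iexp \<theta> * (s * (x - \<i>)) = s * (x + \<i>)"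
    using s by (simp add: x algebra_simps)
  then have "s * (iexp \<theta> * (x - \<i>)) = s * (x + \<i>)"
    by (simp only: mult.left_commute)
  then have "iexp \<theta> * (x - \<i>) = x + \<i>"
    using s mult_left_cancel by blast
  then have e: "iexp \<theta> = (x + \<i>) / (x - \<i>)"
    using xi by (simp only: eq_divide_eq) simp
  have "1 - disc_coord z * iexp \<theta> = 2 * \<i> * (x - z) / ((z + \<i>) * (x - \<i>))"
  proof -
    have "2 * \<i> * (x - z) = (z + \<i>) * (x - \<i>) - (z - \<i>) * (x + \<i>)"
      by (simp add: algebra_simps)
    then show ?thesis
      unfolding e disc_coord_def times_divide_times_eq using xi zi by (simp add: diff_divide_distrib)
  qed
  then have "2 / (1 - disc_coord z * iexp \<theta>) = (z + \<i>) * (x - \<i>) / (\<i> * (x - z))"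
    by (simp only:) simp
  then have "\<i> * (2 / (1 - disc_coord z * iexp \<theta>) - 1) = (z + \<i>) * (x - \<i>) / (x - z) - \<i>"
    by (simp only: right_diff_distrib[of \<i> _ 1] times_divide_eq_right
        mult_divide_mult_cancel_left[OF complex_i_not_zero] mult_1_right)
  also have "\<dots> = (1 + x * z) / (x - z)"
    using xz by (simp add: field_simps)
  finally show ?thesis .
qed

section \<open>Cayley transform and integral representation of the Q-function\<close>

context selfadjoint_operator
begin

lemma resolvent_linear:
  assumes "Im z \<noteq> 0"
  shows "resolvent z (x + c *\<^sub>C y) = resolvent z x + c *\<^sub>C resolvent z y"
proof (rule resolvent_eq[OF assms])
  have "(resolvent z x + c *\<^sub>C resolvent z y,
      (x + z *\<^sub>C resolvent z x) + c *\<^sub>C (y + z *\<^sub>C resolvent z y)) \<in> Q"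
    by (intro Q_add Q_scale resolvent[OF assms])
  moreover have "(x + z *\<^sub>C resolvent z x) + c *\<^sub>C (y + z *\<^sub>C resolvent z y)
      = x + c *\<^sub>C y + z *\<^sub>C (resolvent z x + c *\<^sub>C resolvent z y)"
    by (simp add: scaleC_add_right scaleC_scaleC mult.commute)
  ultimately show "(resolvent z x + c *\<^sub>C resolvent z y,
      x + c *\<^sub>C y + z *\<^sub>C (resolvent z x + c *\<^sub>C resolvent z y)) \<in> Q"
    by simp
qed

text \<open>This is (Q + i)(Q - i)^-1, rewritten with the resolvent alone.\<close>

definition cayley :: "'a \<Rightarrow> 'a" where
  "cayley x = x + (2 * \<i>) *\<^sub>C resolvent \<i> x"

lemma cayley_linear: "cayley (x + c *\<^sub>C y) = cayley x + c *\<^sub>C cayley y"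
  by (simp add: cayley_def resolvent_linear scaleC_add_right scaleC_scaleC mult.commute mult.left_commute)

text \<open>With r = (Q - i)^-1 x and p = Q r, one has x = p - i r and U x = p + i r. The two inner
  products differ only in cross terms, which cancel by symmetry of \<open>Q\<close>.\<close>

lemma cayley_isometry: "cinner (cayley x) (cayley y) = cinner x y"
proof -
  define r s where "r = resolvent \<i> x" and "s = resolvent \<i> y"
  define p q where "p = x + \<i> *\<^sub>C r" and "q = y + \<i> *\<^sub>C s"
  have "(r, p) \<in> Q" "(s, q) \<in> Q"
    using resolvent[of \<i>] by (auto simp: p_def q_def r_def s_def)
  then have sym: "cinner p s = cinner r q"
    by (rule Q_sym)
  have two: "(2 * \<i>) *\<^sub>C v = \<i> *\<^sub>C v + \<i> *\<^sub>C v" for v :: 'a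
    by (simp flip: scaleC_add_left)
  have xy: "x = p - \<i> *\<^sub>C r" "y = q - \<i> *\<^sub>C s"
    by (simp_all add: p_def q_def)
  have "cayley x = p + \<i> *\<^sub>C r" "cayley y = q + \<i> *\<^sub>C s"
    by (simp_all add: cayley_def p_def q_def two flip: r_def s_def)
  then have "cinner (cayley x) (cayley y) = cinner p q + cinner r s + \<i> * cinner r q - \<i> * cinner p s"
    by (simp add: cinner.add_left cinner.add_right cinner_scaleC_left cinner_scaleC_right algebra_simps)
  moreover have "cinner x y = cinner p q + cinner r s - \<i> * cinner r q + \<i> * cinner p s"
    unfolding xy
    by (simp add: cinner.diff_left cinner.diff_right cinner_scaleC_left cinner_scaleC_right algebra_simps)
  ultimately show ?thesis
    by (simp add: sym)
qed

text \<open>Since z + (z^2 + 1) / (x - z) = (1 + x z) / (x - z), for a unit vector \<open>g\<close>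
  this is formally the Nevanlinna kernel integrated against the spectral measure of
  \<open>g\<close>.\<close>

definition Q_function :: "'a \<Rightarrow> complex \<Rightarrow> complex" where
  "Q_function g z = z + (z\<^sup>2 + 1) * cinner (resolvent z g) g"

text \<open>
  In the coordinate \<open>w = disc_coord z\<close> the resolvent becomes \<open>(1 - w U)\<^sup>-\<^sup>1\<close>, a Neumann series in
  the Cayley transform \<open>U\<close>.
\<close>

lemma Q_function_sums:
  assumes z: "Im z > 0" and g: "norm g = 1"
  shows "(\<lambda>k. cinner ((cayley ^^ k) g) g * disc_coord z ^ k) sums ((1 - \<i> * Q_function g z) / 2)"
proof -
  interpret hilbert_isometry cayley g
    by unfold_locales (auto simp: cayley_isometry g)
  define w where "w = disc_coord z"
  define r where "r = resolvent z g"
  \<comment> \<open>Algebra with U = (Q + i)(Q - i)^-1 gives 1 - w U = 2i (Q - z) / ((z + i)(Q -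
    i)). Hence the vector \<open>h\<close> below is (1 - w U)^-1 g.\<close>
  define c where "c = (z + \<i>) / (2 * \<i>)"
  define h where "h = c *\<^sub>C (g + (z - \<i>) *\<^sub>C r)"
  have zi: "z + \<i> \<noteq> 0"
    using z by (rule Im_plus_i_nonzero)
  have "(r, g + z *\<^sub>C r) \<in> Q"
    using resolvent[of z g] z by (simp add: r_def)
  then have "(c *\<^sub>C r, c *\<^sub>C (g + z *\<^sub>C r)) \<in> Q"
    by (rule Q_scale)
  moreover have "c *\<^sub>C (g + z *\<^sub>C r) = h + \<i> *\<^sub>C c *\<^sub>C r"
    by (simp add: h_def scaleC_add_right scaleC_scaleC algebra_simps flip: scaleC_add_left)
  ultimately have "resolvent \<i> h = c *\<^sub>C r"
    by (intro resolvent_eq) auto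
  then have Uh: "cayley h = c *\<^sub>C g + (c * (z + \<i>)) *\<^sub>C r"
    by (simp add: cayley_def h_def scaleC_add_right scaleC_scaleC algebra_simps flip: scaleC_add_left)
  have "h = g + w *\<^sub>C cayley h"
  proof -
    have "g + w *\<^sub>C cayley h = (1 + w * c) *\<^sub>C g + (w * (c * (z + \<i>))) *\<^sub>C r"
      by (simp add: Uh scaleC_add_right scaleC_scaleC scaleC_add_left scaleC_one)
    moreover have "w * c = (z - \<i>) / (2 * \<i>)"
      using zi by (simp add: w_def disc_coord_def c_def)
    then have "1 + w * c = c"
      by (simp add: c_def field_simps)
    moreover have "w * (c * (z + \<i>)) = c * (z - \<i>)"
      using zi by (simp add: w_def disc_coord_def)
    ultimately show ?thesis
      by (simp add: h_def scaleC_add_right scaleC_scaleC)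
  qed
  then have step: "(cayley ^^ k) h = (cayley ^^ k) g + w *\<^sub>C (cayley ^^ Suc k) h" for k
  proof (induction k)
    case (Suc k)
    then show ?case
      by (metis cayley_linear funpow.simps(2) o_apply)
  qed simp
  \<comment> \<open>Iterating h = g + w U h; the remainder is at most |w|^n times the norm of
    \<open>h\<close>, since U is isometric.\<close>
  have partial: "cinner h g = (\<Sum>k<n. moment k * w ^ k) + w ^ n * cinner ((cayley ^^ n) h) g" for n
  proof (induction n)
    case (Suc n)
    have "cinner ((cayley ^^ n) h) g = moment n + w * cinner ((cayley ^^ Suc n) h) g"
      by (subst step) (simp only: cinner.add_left cinner_scaleC_left)
    with Suc show ?case
      by (simp add: algebra_simps)
  qed simp
  have "(\<lambda>n. w ^ n * cinner ((cayley ^^ n) h) g) \<longlonglongrightarrow> 0"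
  proof (rule Lim_null_comparison)
    show "\<forall>\<^sub>F n in sequentially. cmod (w ^ n * cinner ((cayley ^^ n) h) g) \<le> cmod w ^ n * norm h"
    proof (intro always_eventually allI)
      fix n
      have "cmod (cinner ((cayley ^^ n) h) g) \<le> norm h"
        using cinner_Cauchy_Schwarz[of "(cayley ^^ n) h" g] by (simp add: norm_iterate g)
      then show "cmod (w ^ n * cinner ((cayley ^^ n) h) g) \<le> cmod w ^ n * norm h"
        by (simp add: norm_mult norm_power mult_left_mono)
    qed
    show "(\<lambda>n. cmod w ^ n * norm h) \<longlonglongrightarrow> 0"
      using cmod_disc_coord_less[OF z]
      by (intro tendsto_mult_left_zero LIMSEQ_realpow_zero) (auto simp: w_def)
  qed
  then have "(\<lambda>n. cinner h g - w ^ n * cinner ((cayley ^^ n) h) g) \<longlonglongrightarrow> cinner h g - 0"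
    by (intro tendsto_diff tendsto_const)
  moreover have "cinner h g - w ^ n * cinner ((cayley ^^ n) h) g = (\<Sum>k<n. moment k * w ^ k)" for n
    using partial[of n] by simp
  ultimately have "(\<lambda>k. moment k * w ^ k) sums cinner h g"
    by (simp add: sums_def)
  moreover have "cinner h g = (1 - \<i> * Q_function g z) / 2"
  proof -
    have "cinner h g = c * (1 + (z - \<i>) * cinner r g)"
      by (simp add: h_def cinner_scaleC_left cinner.add_left cinner_self g)
    also have "\<dots> = (1 - \<i> * Q_function g z) / 2"
      unfolding c_def Q_function_def r_def[symmetric]
      by (simp add: field_simps power2_eq_square)
    finally show ?thesis .
  qed
  ultimately show ?thesis
    by (simp add: w_def)
qed

text \<open>In the disc coordinate the function is a power series whose coefficients, the moments,
  are bounded by 1; no differentiation of the resolvent is involved.\<close>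

lemma Q_function_holomorphic:
  assumes "norm g = 1"
  shows "Q_function g holomorphic_on {z. Im z > 0}"
proof -
  interpret hilbert_isometry cayley g
    by unfold_locales (auto simp: cayley_isometry assms)
  define S where "S w = (\<Sum>k. moment k * w ^ k)" for w
  have "(\<lambda>k. moment k * (w - 0) ^ k) sums S w" if "w \<in> ball 0 1" for w
  proof -
    have "summable (\<lambda>k. moment k * w ^ k)"
    proof (rule summable_comparison_test')
      show "summable (\<lambda>k. cmod w ^ k)"
        using that by (simp add: summable_geometric)
      show "cmod (moment n * w ^ n) \<le> cmod w ^ n" for n
        using cmod_moment_le[of n] by (simp add: norm_mult norm_power mult_left_le_one_le)
    qed
    then show ?thesis
      by (simp add: S_def summable_sums)
  qed
  then have "S holomorphic_on ball 0 1"
    by (rule power_series_holomorphic)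
  moreover have "disc_coord holomorphic_on {z. Im z > 0}"
    unfolding disc_coord_def[abs_def] using Im_plus_i_nonzero by (intro holomorphic_intros) auto
  moreover have "disc_coord ` {z. Im z > 0} \<subseteq> ball 0 1"
    using cmod_disc_coord_less by auto
  ultimately have "(S \<circ> disc_coord) holomorphic_on {z. Im z > 0}"
    by (meson holomorphic_on_compose_gen)
  then have "(\<lambda>z. \<i> * (2 * (S \<circ> disc_coord) z - 1)) holomorphic_on {z. Im z > 0}"
    by (intro holomorphic_intros)
  moreover have "\<i> * (2 * (S \<circ> disc_coord) z - 1) = Q_function g z" if "Im z > 0" for z
  proof -
    have S_eq: "S (disc_coord z) = (1 - \<i> * Q_function g z) / 2"
      using sums_unique[OF Q_function_sums[OF that assms]] by (simp add: S_def)
    have S_eq2: "2 * S (disc_coord z) = 1 - \<i> * Q_function g z"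
      unfolding S_eq by simp
    show ?thesis
      unfolding o_def S_eq2 by (simp add: right_diff_distrib)
  qed
  ultimately show ?thesis
    by (rule holomorphic_transform) auto
qed

text \<open>The vector g + i y r equals Q r, and (Q r, r) is real. Spectrally the right side is the
  integral of y (1 + x^2) / (x^2 + y^2), so growth in \<open>y\<close> controls the norms of r and Q
  r.\<close>

lemma Im_Q_function_imaginary_axis:
  assumes y: "y > 0" and g: "norm g = 1"
  defines "r \<equiv> resolvent (\<i> * y) g"
  shows "Im (Q_function g (\<i> * y)) = y * ((norm (g + (\<i> * y) *\<^sub>C r))\<^sup>2 + (norm r)\<^sup>2)"
proof -
  define c where "c = cinner g r"
  have "(r, g + (\<i> * y) *\<^sub>C r) \<in> Q"
    unfolding r_def using y by (intro resolvent) simp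
  then have "Im (cinner (g + (\<i> * y) *\<^sub>C r) r) = 0"
    by (rule Q_real)
  moreover have "cinner (g + (\<i> * y) *\<^sub>C r) r = c + \<i> * complex_of_real (y * (norm r)\<^sup>2)"
    unfolding cinner.add_left cinner_scaleC_left cinner_self c_def by simp
  ultimately have Im_c: "Im c = - (y * (norm r)\<^sup>2)"
    by simp
  have "Re (cnj (\<i> * y) * c) = y * Im c"
    by simp
  then have norm: "(norm (g + (\<i> * y) *\<^sub>C r))\<^sup>2 = 1 - y\<^sup>2 * (norm r)\<^sup>2"
    unfolding cinner_expand c_def[symmetric] Im_c using y g
    by (simp add: norm_mult power_mult_distrib power2_eq_square algebra_simps)
  have "Q_function g (\<i> * y) = \<i> * y + complex_of_real (1 - y\<^sup>2) * cnj c"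
    unfolding Q_function_def r_def[symmetric] c_def cinner_commute[of g r] complex_cnj_cnj
    by (simp add: power_mult_distrib)
  then have "Im (Q_function g (\<i> * y)) = y + (1 - y\<^sup>2) * (y * (norm r)\<^sup>2)"
    by (simp add: Im_c)
  then show ?thesis
    unfolding norm by (simp add: algebra_simps)
qed

lemma resolvent_strong_limit:
  "((\<lambda>y. g + (\<i> * complex_of_real y) *\<^sub>C resolvent (\<i> * complex_of_real y) g) \<longlongrightarrow> 0) at_top"
proof (rule tendstoI)
  define k where "k y x = x + (\<i> * complex_of_real y) *\<^sub>C resolvent (\<i> * complex_of_real y) x" for y x
  fix \<epsilon> :: real assume \<epsilon>: "\<epsilon> > 0"
  then have "\<epsilon> / 4 > 0" by simp
  moreover have "g \<in> closure (Domain Q)"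
    by (simp add: dense_Domain)
  ultimately have "\<exists>e\<in>Domain Q. dist e g < \<epsilon> / 4"
    unfolding closure_approachable by blast
  then obtain e p where e: "(e, p) \<in> Q" "norm (g - e) < \<epsilon> / 4"
    by (auto simp: dist_norm norm_minus_commute)
  have "norm (k y g) < \<epsilon>" if y: "y > 0" "y > 2 * norm p / \<epsilon>" for y
  proof -
    have Im: "Im (\<i> * complex_of_real y) \<noteq> 0" and abs: "\<bar>Im (\<i> * complex_of_real y)\<bar> = y"
      using y by auto
    \<comment> \<open>The operators Q (Q - i y)^-1 are bounded by 2 uniformly in y, so it suffices
      to treat the dense domain of \<open>Q\<close>; this fixes the approximation error
      \<epsilon>/4.\<close>
    have k_le: "norm (k y x) \<le> 2 * norm x" for x
    proof -
      have "norm (k y x) \<le> norm x + y * norm (resolvent (\<i> * complex_of_real y) x)"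
        unfolding k_def using y
        by (intro order.trans[OF norm_triangle_ineq]) (simp add: norm_scaleC norm_mult)
      then show ?thesis
        using norm_resolvent_le[OF Im, of x] abs by simp
    qed
    \<comment> \<open>On the domain, Q commutes with its resolvent, and the resolvent contributes a
      factor 1/y.\<close>
    have "k y e = resolvent (\<i> * complex_of_real y) p"
    proof (rule resolvent_eq[OF Im, symmetric])
      have "(e + (\<i> * complex_of_real y) *\<^sub>C resolvent (\<i> * complex_of_real y) e,
          p + (\<i> * complex_of_real y) *\<^sub>C
            (e + (\<i> * complex_of_real y) *\<^sub>C resolvent (\<i> * complex_of_real y) e)) \<in> Q"
        by (intro Q_add Q_scale resolvent Im e)
      then show "(k y e, p + (\<i> * complex_of_real y) *\<^sub>C k y e) \<in> Q"
        by (simp add: k_def)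
    qed
    then have "y * norm (k y e) \<le> norm p"
      using norm_resolvent_le[OF Im, of p] abs by simp
    also have "norm p < y * (\<epsilon> / 2)"
      using y \<epsilon> by (simp add: field_simps)
    finally have "norm (k y e) < \<epsilon> / 2"
      using y by simp
    moreover have "k y g = k y e + k y (g - e)"
      using resolvent_linear[OF Im, of e 1 "g - e"]
      by (simp add: k_def scaleC_one scaleC_add_right)
    ultimately show ?thesis
      using norm_triangle_ineq[of "k y e" "k y (g - e)"] k_le[of "g - e"] e(2) by simp
  qed
  moreover have "\<forall>\<^sub>F y in at_top. y > 0 \<and> y > 2 * norm p / \<epsilon>"
    by (intro eventually_conj eventually_gt_at_top)
  ultimately show "\<forall>\<^sub>F y in at_top. dist (g + (\<i> * complex_of_real y) *\<^sub>C
      resolvent (\<i> * complex_of_real y) g) 0 < \<epsilon>"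
    unfolding k_def by (auto elim: eventually_mono)
qed

text \<open>The limit measures the mass of the spectral measure at infinity; its vanishing will
  exclude the point 1 of the circle.\<close>

lemma Q_function_linear_growth:
  assumes g: "norm g = 1"
  shows "((\<lambda>y. Im (Q_function g (\<i> * complex_of_real y)) / y) \<longlongrightarrow> 0) at_top"
proof -
  define r k where "r y = resolvent (\<i> * complex_of_real y) g"
    and "k y = g + (\<i> * complex_of_real y) *\<^sub>C r y" for y
  have k: "((\<lambda>y. (norm (k y))\<^sup>2) \<longlongrightarrow> 0) at_top"
    using tendsto_power[OF tendsto_norm[OF resolvent_strong_limit[of g]], of 2]
    by (simp add: k_def r_def)
  have "(r \<longlongrightarrow> 0) at_top"
  proof (rule Lim_null_comparison)
    show "\<forall>\<^sub>F y in at_top. norm (r y) \<le> 1 / y"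
      using eventually_gt_at_top[of 0]
    proof eventually_elim
      case (elim y)
      then show ?case
        using norm_resolvent_le[of "\<i> * complex_of_real y" g] g
        by (simp add: r_def field_simps)
    qed
    show "((\<lambda>y :: real. 1 / y) \<longlongrightarrow> 0) at_top"
      by real_asymp
  qed
  from tendsto_power[OF tendsto_norm[OF this], of 2]
  have "((\<lambda>y. (norm (r y))\<^sup>2) \<longlongrightarrow> 0) at_top"
    by simp
  from tendsto_add[OF k this] have "((\<lambda>y. (norm (k y))\<^sup>2 + (norm (r y))\<^sup>2) \<longlongrightarrow> 0) at_top"
    by simp
  moreover have "\<forall>\<^sub>F y in at_top. (norm (k y))\<^sup>2 + (norm (r y))\<^sup>2 = Im (Q_function g (\<i> * complex_of_real y)) / y"
    using eventually_gt_at_top[of 0]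
    by eventually_elim (simp add: Im_Q_function_imaginary_axis g k_def r_def)
  ultimately show ?thesis
    by (rule Lim_transform_eventually)
qed

theorem Q_function_representation:
  assumes g: "norm g = 1"
  obtains \<nu> where "real_distribution \<nu>"
    "\<And>z. Im z > 0 \<Longrightarrow> Q_function g z = (CLINT x|\<nu>. (1 + complex_of_real x * z) / (complex_of_real x - z))"
proof -
  interpret hilbert_isometry cayley g
    by unfold_locales (auto simp: cayley_isometry g)
  obtain \<rho> where \<rho>: "real_distribution \<rho>" and moments: "\<And>k. char \<rho> (real k) = moment k"
    using moment_measure by blast
  interpret \<rho>: real_distribution \<rho> by (rule \<rho>)
  \<comment> \<open>The Herglotz kernel i (1 + w e) / (1 - w e), written so that a geometric series
    integrates term by term. Here \<kappa> is a kernel, not the von Neumann parameter.\<close>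
  define \<kappa> where "\<kappa> w \<theta> = \<i> * (2 / (1 - w * iexp \<theta>) - 1)" for w and \<theta> :: real
  have norm_iexp: "cmod (iexp \<theta>) = 1" for \<theta> :: real
    by simp
  have denom: "1 - cmod w \<le> cmod (1 - w * iexp \<theta>)" for w and \<theta> :: real
    using norm_triangle_ineq2[of 1 "w * iexp \<theta>"] by (simp add: norm_mult)
  have denom_int: "integrable \<rho> (\<lambda>\<theta>. 1 / (1 - w * iexp \<theta>))" if w: "cmod w < 1" for w
  proof (rule \<rho>.integrable_const_bound[of _ "1 / (1 - cmod w)"])
    show "AE \<theta> in \<rho>. cmod (1 / (1 - w * iexp \<theta>)) \<le> 1 / (1 - cmod w)"
      using denom[of w] w by (intro AE_I2) (auto simp: norm_divide intro!: divide_left_mono mult_pos_pos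
          intro: less_le_trans[of 0 "1 - cmod w"])
  qed measurable
  have \<kappa>_int: "integrable \<rho> (\<kappa> w)" if w: "cmod w < 1" for w
  proof -
    have "integrable \<rho> (\<lambda>\<theta>. \<i> * (2 * (1 / (1 - w * iexp \<theta>)) - 1))"
      by (intro integrable_mult_right Bochner_Integration.integrable_diff denom_int w) simp
    then show ?thesis
      by (simp add: \<kappa>_def[abs_def])
  qed
  have Q_\<kappa>: "Q_function g z = (\<integral>\<theta>. \<kappa> (disc_coord z) \<theta> \<partial>\<rho>)" if z: "Im z > 0" for z
  proof -
    define w where "w = disc_coord z"
    have w: "cmod w < 1"
      unfolding w_def by (rule cmod_disc_coord_less[OF z])
    have geom: "(\<lambda>k. w ^ k * iexp (real k * \<theta>)) sums (1 / (1 - w * iexp \<theta>))" for \<theta> :: real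
    proof -
      have "w ^ k * iexp (real k * \<theta>) = (w * iexp \<theta>) ^ k" for k
        by (simp add: power_mult_distrib exp_of_nat_mult[symmetric] mult_ac)
      then show ?thesis
        using geometric_sums[of "w * iexp \<theta>"] w by (simp add: norm_mult)
    qed
    \<comment> \<open>Integrating the geometric series termwise gives the same power series as the
      Neumann series of the resolvent, so the sums agree.\<close>
    have "(\<lambda>k. \<integral>\<theta>. w ^ k * iexp (real k * \<theta>) \<partial>\<rho>) sums (\<integral>\<theta>. (\<Sum>k. w ^ k * iexp (real k * \<theta>)) \<partial>\<rho>)"
    proof (rule sums_integral)
      show "integrable \<rho> (\<lambda>\<theta>. w ^ k * iexp (real k * \<theta>))" for k
        by (intro integrable_mult_right \<rho>.integrable_const_bound[of _ 1]) auto
      show "AE \<theta> in \<rho>. summable (\<lambda>k. cmod (w ^ k * iexp (real k * \<theta>)))"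
        using w by (simp add: norm_mult norm_power summable_geometric)
      show "summable (\<lambda>k. \<integral>\<theta>. cmod (w ^ k * iexp (real k * \<theta>)) \<partial>\<rho>)"
        using w by (simp add: norm_mult norm_power summable_geometric \<rho>.prob_space)
    qed
    also have "(\<lambda>k. \<integral>\<theta>. w ^ k * iexp (real k * \<theta>) \<partial>\<rho>) = (\<lambda>k. moment k * w ^ k)"
      unfolding moments[symmetric] char_def by (auto simp: mult.commute)
    also have "(\<lambda>\<theta>. \<Sum>k. w ^ k * iexp (real k * \<theta>)) = (\<lambda>\<theta>. 1 / (1 - w * iexp \<theta>))"
      using geom by (simp add: sums_iff)
    finally have "(\<lambda>k. moment k * w ^ k) sums (\<integral>\<theta>. 1 / (1 - w * iexp \<theta>) \<partial>\<rho>)" .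
    then have neumann: "(\<integral>\<theta>. 1 / (1 - w * iexp \<theta>) \<partial>\<rho>) = (1 - \<i> * Q_function g z) / 2"
      unfolding w_def by (rule sums_unique2[OF _ Q_function_sums[OF z g]])
    have "(\<integral>\<theta>. \<i> * (2 * D \<theta> - 1) \<partial>\<rho>) = \<i> * (2 * (\<integral>\<theta>. D \<theta> \<partial>\<rho>) - 1)"
      if "integrable \<rho> D" for D :: "real \<Rightarrow> complex"
      using that by (simp add: Bochner_Integration.integral_diff \<rho>.prob_space[simplified])
    moreover have "\<i> * (2 * ((1 - \<i> * q) / 2) - 1) = q" for q
      by (simp add: field_simps)
    ultimately
    have "(\<integral>\<theta>. \<i> * (2 * (1 / (1 - w * iexp \<theta>)) - 1) \<partial>\<rho>) = Q_function g z"
      using denom_int[OF w] by (simp only: neumann)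
    then show ?thesis
      by (simp add: \<kappa>_def w_def right_diff_distrib)
  qed
  \<comment> \<open>The angles sent to infinity by the cotangent. All multiples of 2 pi are taken,
    so no statement on the support of \<rho> is required.\<close>
  define P where "P = {\<theta> :: real. iexp \<theta> = 1}"
  have P_meas [measurable]: "P \<in> sets borel"
    unfolding P_def by measurable
  \<comment> \<open>At z = i y the kernel has imaginary part exactly y on \<open>P\<close> and
    nonnegative imaginary part elsewhere; mass on \<open>P\<close> would therefore force linear
    growth.\<close>
  have P_bound: "measure \<rho> P \<le> Im (Q_function g (\<i> * complex_of_real y)) / y" if y: "y > 0" for y
  proof -
    define w where "w = disc_coord (\<i> * complex_of_real y)"
    have w_eq: "w = complex_of_real ((y - 1) / (y + 1))"
      using y by (simp add: w_def disc_coord_def complex_eq_iff Re_divide Im_divide field_simps power2_eq_square)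
    have w: "cmod w < 1"
      unfolding w_def using y by (intro cmod_disc_coord_less) simp
    have nonneg: "0 \<le> Im (\<kappa> w \<theta>)" for \<theta>
    proof -
      have "1 - w * iexp \<theta> \<noteq> 0"
        using denom[of w \<theta>] w by auto
      then have "\<kappa> w \<theta> = \<i> * ((1 + w * iexp \<theta>) / (1 - w * iexp \<theta>))"
        unfolding \<kappa>_def by (simp add: field_simps)
      also have "Im \<dots> = Re ((1 + w * iexp \<theta>) * cnj (1 - w * iexp \<theta>)) / (cmod (1 - w * iexp \<theta>))\<^sup>2"
        unfolding Im_i_times Re_divide'
        by (simp only: times_complex.sel cnj.sel mult_minus_right diff_minus_eq_add)
      also have "Re ((1 + w * iexp \<theta>) * cnj (1 - w * iexp \<theta>)) = 1 - (cmod (w * iexp \<theta>))\<^sup>2"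
        unfolding cmod_power2 by (simp add: algebra_simps power2_eq_square)
      finally show ?thesis
        using w norm_iexp[of \<theta>] by (simp add: norm_mult power_le_one)
    qed
    have "y * measure \<rho> P = (\<integral>\<theta>. y * indicator P \<theta> \<partial>\<rho>)"
      by simp
    also have "\<dots> \<le> (\<integral>\<theta>. Im (\<kappa> w \<theta>) \<partial>\<rho>)"
    proof (rule integral_mono)
      show "integrable \<rho> (\<lambda>\<theta>. y * indicator P \<theta>)"
        by (intro integrable_mult_right \<rho>.integrable_const_bound[of _ 1]) (auto simp: indicator_def)
      show "integrable \<rho> (\<lambda>\<theta>. Im (\<kappa> w \<theta>))"
        using \<kappa>_int[OF w] by simp
      fix \<theta>
      have "Im (\<kappa> w \<theta>) = y" if "\<theta> \<in> P"
      proof -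
        have "\<kappa> w \<theta> = \<i> * (2 / (1 - w) - 1)"
          using that by (simp add: \<kappa>_def P_def)
        also have "\<dots> = \<i> * y"
          unfolding w_eq using y by (simp add: complex_eq_iff field_simps Re_divide)
        finally show ?thesis by simp
      qed
      then show "y * indicator P \<theta> \<le> Im (\<kappa> w \<theta>)"
        using nonneg[of \<theta>] by (auto simp: indicator_def)
    qed
    also have "\<dots> = Im (Q_function g (\<i> * complex_of_real y))"
      using \<kappa>_int[OF w] y by (simp add: Q_\<kappa> w_def)
    finally show ?thesis
      using y by (simp add: field_simps)
  qed
  have "measure \<rho> P \<le> 0"
  proof (rule tendsto_lowerbound[OF Q_function_linear_growth[OF g]])
    show "\<forall>\<^sub>F y in at_top. measure \<rho> P \<le> Im (Q_function g (\<i> * complex_of_real y)) / y"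
      using eventually_gt_at_top[of 0] by eventually_elim (rule P_bound)
  qed simp
  then have "measure \<rho> P = 0"
    using measure_nonneg[of \<rho> P] by linarith
  then have "AE \<theta> in \<rho>. \<theta> \<notin> P"
    by (intro AE_not_in) (auto simp: null_sets_def \<rho>.emeasure_eq_measure)
  moreover have "\<theta> \<in> P" if "sin (\<theta> / 2) = 0" for \<theta> :: real
  proof -
    have "iexp \<theta> = iexp (\<theta> / 2) * iexp (\<theta> / 2)"
      unfolding exp_add[symmetric] by simp
    also have "\<dots> = complex_of_real ((cos (\<theta> / 2))\<^sup>2)"
      unfolding cis_conv_exp[symmetric] using that by (simp add: complex_eq_iff power2_eq_square)
    also have "(cos (\<theta> / 2))\<^sup>2 = 1"
      using sin_cos_squared_add[of "\<theta> / 2"] that by simp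
    finally show ?thesis
      by (simp add: P_def)
  qed
  ultimately have AE: "AE \<theta> in \<rho>. sin (\<theta> / 2) \<noteq> 0"
    by (auto elim: AE_mp)
  have cot [measurable]: "(\<lambda>\<theta>. cot (\<theta> / 2)) \<in> \<rho> \<rightarrow>\<^sub>M (borel :: real measure)"
    unfolding cot_def by measurable
  show ?thesis
  proof (rule that)
    show "real_distribution (distr \<rho> borel (\<lambda>\<theta>. cot (\<theta> / 2)))"
      by (intro \<rho>.real_distribution_distr cot)
    fix z :: complex assume z: "Im z > 0"
    have "Q_function g z = (\<integral>\<theta>. \<kappa> (disc_coord z) \<theta> \<partial>\<rho>)"
      by (rule Q_\<kappa>[OF z])
    also have "\<dots> = (\<integral>\<theta>. (1 + complex_of_real (cot (\<theta> / 2)) * z) / (complex_of_real (cot (\<theta> / 2)) - z) \<partial>\<rho>)"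
    proof (rule integral_cong_AE)
      show "AE \<theta> in \<rho>. \<kappa> (disc_coord z) \<theta>
          = (1 + complex_of_real (cot (\<theta> / 2)) * z) / (complex_of_real (cot (\<theta> / 2)) - z)"
        using AE by eventually_elim (simp add: \<kappa>_def cot_Moebius z)
      show "\<kappa> (disc_coord z) \<in> borel_measurable \<rho>"
        using \<kappa>_int[OF cmod_disc_coord_less[OF z]] by simp
    qed measurable
    also have "\<dots> = (CLINT x|distr \<rho> borel (\<lambda>\<theta>. cot (\<theta> / 2)). (1 + complex_of_real x * z) / (complex_of_real x - z))"
      by (rule integral_distr[symmetric]) (use cot in measurable)
    finally show "Q_function g z = (CLINT x|distr \<rho> borel (\<lambda>\<theta>. cot (\<theta> / 2)).
        (1 + complex_of_real x * z) / (complex_of_real x - z))" .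
  qed
qed

end

section \<open>Positivity, and the infinite second moment of a deficiency vector\<close>

lemma Im_nevanlinna_kernel:
  "Im ((1 + complex_of_real x * z) / (complex_of_real x - z)) = Im z * (1 + x\<^sup>2) / (cmod (complex_of_real x - z))\<^sup>2"
  unfolding Im_divide' by (simp add: power2_eq_square algebra_simps)

text \<open>The kernel is z + (1 + z^2) / (x - z), and |x - z| is at least Im z, so it is bounded in
  x.\<close>

lemma integrable_nevanlinna_kernel:
  assumes "real_distribution \<nu>" and z: "Im z > 0"
  shows "integrable \<nu> (\<lambda>x. (1 + complex_of_real x * z) / (complex_of_real x - z))"
proof -
  interpret real_distribution \<nu> by fact
  have le: "Im z \<le> cmod (complex_of_real x - z)" for x
    using abs_Im_le_cmod[of "complex_of_real x - z"] z by simp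
  have nz: "complex_of_real x - z \<noteq> 0" for x
    using z by (auto simp: complex_eq_iff)
  have "integrable \<nu> (\<lambda>x. 1 / (complex_of_real x - z))"
  proof (rule integrable_const_bound[of _ "1 / Im z"])
    show "AE x in \<nu>. cmod (1 / (complex_of_real x - z)) \<le> 1 / Im z"
      using le z nz by (auto simp: norm_divide intro!: divide_left_mono mult_pos_pos)
  qed measurable
  then have "integrable \<nu> (\<lambda>x. z + (1 + z * z) * (1 / (complex_of_real x - z)))"
    by (intro Bochner_Integration.integrable_add integrable_mult_right) auto
  moreover have "z + (1 + z * z) * (1 / (complex_of_real x - z)) = (1 + complex_of_real x * z) / (complex_of_real x - z)" for x
    using nz[of x] by (simp add: field_simps)
  ultimately show ?thesis by simp
qed

context selfadjoint_operator
begin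

lemma Im_Q_function:
  assumes \<nu>: "real_distribution \<nu>"
    and rep: "\<And>z. Im z > 0 \<Longrightarrow> Q_function g z = (CLINT x|\<nu>. (1 + complex_of_real x * z) / (complex_of_real x - z))"
    and z: "Im z > 0"
  shows "Im (Q_function g z) = (\<integral>x. Im z * (1 + x\<^sup>2) / (cmod (complex_of_real x - z))\<^sup>2 \<partial>\<nu>)"
    and "integrable \<nu> (\<lambda>x. Im z * (1 + x\<^sup>2) / (cmod (complex_of_real x - z))\<^sup>2)"
  using integrable_Im[OF integrable_nevanlinna_kernel[OF \<nu> z]] integral_Im[OF integrable_nevanlinna_kernel[OF \<nu> z]]
  unfolding rep[OF z] Im_nevanlinna_kernel by auto

lemma Im_Q_function_pos:
  assumes \<nu>: "real_distribution \<nu>"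
    and rep: "\<And>z. Im z > 0 \<Longrightarrow> Q_function g z = (CLINT x|\<nu>. (1 + complex_of_real x * z) / (complex_of_real x - z))"
    and z: "Im z > 0"
  shows "Im (Q_function g z) > 0"
proof -
  interpret real_distribution \<nu> by fact
  let ?f = "\<lambda>x. Im z * (1 + x\<^sup>2) / (cmod (complex_of_real x - z))\<^sup>2"
  have pos: "?f x > 0" for x
  proof -
    have "complex_of_real x - z \<noteq> 0"
      using z by (auto simp: complex_eq_iff)
    moreover have "1 + x\<^sup>2 > 0"
      by (simp add: add_pos_nonneg)
    ultimately show ?thesis
      using z by simp
  qed
  have "(\<integral>x. ?f x \<partial>\<nu>) \<noteq> 0"
  proof
    assume "(\<integral>x. ?f x \<partial>\<nu>) = 0"
    then have "AE x in \<nu>. ?f x = 0"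
      using integral_nonneg_eq_0_iff_AE[OF Im_Q_function(2)[OF \<nu> rep z]] pos by (simp add: less_imp_le)
    then have "AE x in \<nu>. False"
    proof eventually_elim
      case (elim x)
      then show ?case
        using pos[of x] by (simp only: less_irrefl)
    qed
    then show False by simp
  qed
  moreover have "(\<integral>x. ?f x \<partial>\<nu>) \<ge> 0"
    by (intro integral_nonneg_AE) (simp add: pos less_imp_le)
  moreover have "Im (Q_function g z) = (\<integral>x. ?f x \<partial>\<nu>)"
    using \<nu> rep z by (rule Im_Q_function(1))
  ultimately show ?thesis
    by linarith
qed

text \<open>
  If \<open>g\<close> had finite second moment, then \<open>- \<i> y Q (Q - \<i> y)\<^sup>-\<^sup>1 g\<close> would stay bounded and converge
  weakly to \<open>\<i> g\<close>, although the imaginary part of its product with \<open>g\<close> is not positive.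
\<close>

lemma deficiency_vector_unbounded:
  assumes A: "A \<subseteq> Q" "densely_defined A" "(g, \<i> *\<^sub>C g) \<in> adj A" and g: "norm g = 1"
    and bound: "\<And>y. y > 0 \<Longrightarrow> Im (Q_function g (\<i> * complex_of_real y)) \<le> D / y"
  shows False
proof -
  define B where "B = sqrt \<bar>D\<bar>"
  have B: "B \<ge> 0"
    by (simp add: B_def)
  \<comment> \<open>Replacing \<open>g\<close> by \<open>e\<close> costs an error with factor 1 in
    one term and factor \<open>B\<close> in another; this radius keeps their sum below 1/2.\<close>
  have "1 / (2 * (1 + B)) > 0"
    using B by simp
  moreover have "g \<in> closure (Domain A)"
    using A(2) by (simp add: densely_defined_def)
  ultimately have "\<exists>e\<in>Domain A. dist e g < 1 / (2 * (1 + B))"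
    unfolding closure_approachable by blast
  then obtain e p where e: "(e, p) \<in> A" "dist e g < 1 / (2 * (1 + B))"
    by blast
  then have eg: "(1 + B) * norm (e - g) < 1 / 2"
    using B by (simp add: dist_norm field_simps)
  \<comment> \<open>Chosen so that B times the norm of \<open>p\<close> is below y/2, which makes
    (k, p) smaller than 1/2.\<close>
  define y where "y = 2 * B * norm p + 1"
  have y: "y > 0"
    using B by (simp add: y_def add_nonneg_pos)
  define r k where "r = resolvent (\<i> * complex_of_real y) g"
    and "k = g + (\<i> * complex_of_real y) *\<^sub>C r"
  have rk: "(r, k) \<in> Q"
    unfolding r_def k_def using y by (intro resolvent) simp
  have "y * ((norm k)\<^sup>2 + (norm r)\<^sup>2) \<le> D / y"
    using bound[OF y] Im_Q_function_imaginary_axis[OF y g] by (simp add: r_def k_def)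
  then have "y * (y * ((norm k)\<^sup>2 + (norm r)\<^sup>2)) \<le> D"
    using y by (simp add: field_simps)
  moreover have "(y * norm k)\<^sup>2 \<le> y * (y * ((norm k)\<^sup>2 + (norm r)\<^sup>2))"
    using y by (simp add: power2_eq_square algebra_simps)
  ultimately have "(y * norm k)\<^sup>2 \<le> \<bar>D\<bar>"
    by linarith
  then have yk: "y * norm k \<le> B"
    unfolding B_def by (rule real_le_rsqrt)
  define P where "P = (- \<i> * complex_of_real y) *\<^sub>C k"
  have P: "norm P \<le> B"
    using yk y by (simp add: P_def norm_scaleC norm_mult)
  \<comment> \<open>As (k, r) is real, Re (k, g) is the squared norm of \<open>k\<close>; hence Im
    (P, g) = - y times that, which is not positive.\<close>
  have "cinner k g = cinner k k - cnj (\<i> * complex_of_real y) * cinner k r"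
  proof -
    have "g = k - (\<i> * complex_of_real y) *\<^sub>C r"
      by (simp add: k_def)
    then have "cinner k g = cinner k (k - (\<i> * complex_of_real y) *\<^sub>C r)"
      by simp
    then show ?thesis
      by (simp only: cinner.diff_right cinner_scaleC_right)
  qed
  then have "Re (cinner k g) = (norm k)\<^sup>2"
    using Q_real[OF rk] by (simp add: cinner_self)
  then have Im_P: "Im (cinner P g) \<le> 0"
    using y by (simp add: P_def cinner_scaleC_left cinner.minus_left)
  \<comment> \<open>Symmetry of \<open>Q\<close> moves the operator onto \<open>e\<close> in the
    domain of \<open>A\<close>. Then -i y r = g - k and the eigenvector equation for
    \<open>g\<close> produce i (g, e), up to the small term (k, p).\<close>
  have "cinner k e = cinner r p"
    using Q_sym[OF rk] e(1) A(1) by blast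
  then have "cinner P e = cinner ((- \<i> * complex_of_real y) *\<^sub>C r) p"
    by (simp add: P_def cinner_scaleC_left cinner.minus_left)
  also have "(- \<i> * complex_of_real y) *\<^sub>C r = g - k"
    by (simp add: k_def complex_vector.scale_minus_left)
  also have "cinner (g - k) p = \<i> * cinner g e - cinner k p"
  proof -
    have "cinner p g = cinner e (\<i> *\<^sub>C g)"
      using adjD[OF A(3) e(1)] .
    then have "cinner g p = cinner (\<i> *\<^sub>C g) e"
      using cinner_commute[of g p] cinner_commute[of "\<i> *\<^sub>C g" e] by simp
    then show ?thesis
      by (simp add: cinner.diff_left cinner_scaleC_left)
  qed
  finally have Pe: "cinner P e = \<i> * cinner g e - cinner k p" .
  have gg: "cinner g g = 1"
    by (simp add: cinner_self g)
  have "cinner P g - \<i> = \<i> * cinner g (e - g) - cinner k p - cinner P (e - g)"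
    by (simp add: cinner.diff_right Pe gg algebra_simps)
  then have "cmod (cinner P g - \<i>) \<le> cmod (cinner g (e - g)) + cmod (cinner k p) + cmod (cinner P (e - g))"
    using norm_triangle_ineq4[of "\<i> * cinner g (e - g) - cinner k p" "cinner P (e - g)"]
      norm_triangle_ineq4[of "\<i> * cinner g (e - g)" "cinner k p"] by (simp add: norm_mult)
  moreover have "cmod (cinner g (e - g)) \<le> norm (e - g)"
    using cinner_Cauchy_Schwarz[of g "e - g"] g by simp
  moreover have "cmod (cinner P (e - g)) \<le> B * norm (e - g)"
    using cinner_Cauchy_Schwarz[of P "e - g"] mult_right_mono[OF P norm_ge_zero[of "e - g"]] by linarith
  moreover have "cmod (cinner k p) < 1 / 2"
  proof -
    have "y * (norm k * norm p) \<le> B * norm p"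
      using mult_right_mono[OF yk norm_ge_zero[of p]] by (simp add: mult.assoc)
    also have "\<dots> < y * (1 / 2)"
      by (simp add: y_def)
    finally have "norm k * norm p < 1 / 2"
      using y mult_less_cancel_left_pos by blast
    then show ?thesis
      using cinner_Cauchy_Schwarz[of k p] by linarith
  qed
  \<comment> \<open>A number with nonpositive imaginary part is at distance at least 1 from i, while
    the errors add up to less than 1.\<close>
  moreover have "1 \<le> cmod (cinner P g - \<i>)"
    using abs_Im_le_cmod[of "cinner P g - \<i>"] Im_P by simp
  ultimately show False
    using eg by (simp add: algebra_simps)
qed

end

section \<open>The impedance function of an L-system\<close>

lemma hminusD:
  assumes "\<phi> \<in> hminus A"
  shows "f \<in> hplus A \<Longrightarrow> h \<in> hplus A \<Longrightarrow> \<phi> (f + h) = \<phi> f + \<phi> h"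
    and "f \<in> hplus A \<Longrightarrow> \<phi> (c *\<^sub>C f) = cnj c * \<phi> f"
    and "f \<notin> hplus A \<Longrightarrow> \<phi> f = 0"
  using assms by (auto simp: hminus_def)

lemma hplusI: "(f, g) \<in> adj A \<Longrightarrow> f \<in> hplus A"
  by (auto simp: hplus_def)

lemma hplus_add: "f \<in> hplus A \<Longrightarrow> g \<in> hplus A \<Longrightarrow> f + g \<in> hplus A"
  unfolding hplus_def by (blast intro: adj_add)

lemma hplus_scale: "f \<in> hplus A \<Longrightarrow> c *\<^sub>C f \<in> hplus A"
  unfolding hplus_def by (blast intro: adj_scale)

lemma hplus_diff: "f \<in> hplus A \<Longrightarrow> g \<in> hplus A \<Longrightarrow> f - g \<in> hplus A"
  unfolding hplus_def by (blast intro: adj_diff)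

context
  fixes A :: "'a::chilbert_space operator" and B :: "'a \<Rightarrow> 'a \<Rightarrow> complex"
  assumes B: "bounded_plus_minus A B"
begin

lemma Re_pm_add:
  assumes f: "f \<in> hplus A" "f' \<in> hplus A" and h: "h \<in> hplus A"
  shows "Re_pm B (f + f') h = Re_pm B f h + Re_pm B f' h"
proof -
  have "B (f + f') h = B f h + B f' h" "B h (f + f') = B h f + B h f'"
    using B f h hminusD(1)[of "B h" A f f'] by (auto simp: bounded_plus_minus_def)
  then show ?thesis
    by (simp add: Re_pm_def adj_pm_def add_divide_distrib)
qed

lemma Re_pm_scale:
  assumes f: "f \<in> hplus A" and h: "h \<in> hplus A"
  shows "Re_pm B (c *\<^sub>C f) h = c * Re_pm B f h"
proof -
  have "B (c *\<^sub>C f) h = c * B f h" "B h (c *\<^sub>C f) = cnj c * B h f"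
    using B f h hminusD(2)[of "B h" A f c] by (auto simp: bounded_plus_minus_def)
  then show ?thesis
    by (simp add: Re_pm_def adj_pm_def algebra_simps)
qed

lemma Re_pm_diff:
  assumes f: "f \<in> hplus A" "f' \<in> hplus A" and h: "h \<in> hplus A"
  shows "Re_pm B (f - f') h = Re_pm B f h - Re_pm B f' h"
  using Re_pm_add[OF f(1) hplus_scale[OF f(2), of "-1"] h] Re_pm_scale[OF f(2) h, of "-1"]
  by (simp add: complex_vector.scale_minus_left scaleC_one)

text \<open>Equality in the dual space is equality of total functions, so values outside
  \<open>hplus A\<close> must be matched as well.\<close>

lemma Re_pm_outside:
  assumes "f \<in> hplus A" "h \<notin> hplus A"
  shows "Re_pm B f h = 0"
proof -
  have "B f h = 0" "B h f = 0"
    using B assms hminusD(3)[of "B f" A h] by (auto simp: bounded_plus_minus_def)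
  then show ?thesis
    by (simp add: Re_pm_def adj_pm_def)
qed

end

lemma Re_pm_hermitian: "Re_pm B f h = cnj (Re_pm B h f)"
  by (simp add: Re_pm_def adj_pm_def add.commute)

text \<open>Hypothesis I places \<open>gp - \<kappa> gm\<close> in the domain of T;
  \<open>main_domain\<close> says that nothing else is added to the domain of \<open>A\<close>,
  which gives access to the adjoint of T. For a coupling this is part of how T is defined.\<close>

locale lsystem_hypothesis_I =
  fixes \<Theta> :: "'a::chilbert_space lsystem" and gp gm :: 'a and \<kappa> :: real
  assumes lsystem: "is_lsystem \<Theta>"
    and hypothesis: "hypothesis_I \<Theta> gp gm \<kappa>"
    and main_domain: "Domain (main_op \<Theta>) \<subseteq> dom_plus_span (sym_op \<Theta>) (gp - \<kappa> *\<^sub>R gm)"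
begin

abbreviation "A \<equiv> sym_op \<Theta>"
abbreviation "T \<equiv> main_op \<Theta>"
abbreviation "B \<equiv> state_op \<Theta>"
abbreviation "R \<equiv> Re_pm (state_op \<Theta>)"
abbreviation "a \<equiv> adj_channel (channel \<Theta>)"
text \<open>Boundary vectors of T and of its adjoint; \<open>At\<close> and \<open>As\<close> are
  the values of \<open>adj A\<close> at \<open>t\<close> and \<open>s\<close>.\<close>

abbreviation "t \<equiv> gp - \<kappa> *\<^sub>C gm"
abbreviation "At \<equiv> \<i> *\<^sub>C (gp + \<kappa> *\<^sub>C gm)"
abbreviation "s \<equiv> \<kappa> *\<^sub>C gp - gm"
abbreviation "As \<equiv> \<i> *\<^sub>C (\<kappa> *\<^sub>C gp + gm)"

lemma bounded_B: "bounded_plus_minus A B"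
  using lsystem by (simp add: is_lsystem_def star_extension_def)

lemma dense_A: "densely_defined A"
  using lsystem by (simp add: is_lsystem_def symmetric_op_def)

lemma \<kappa>: "0 \<le> \<kappa>" "\<kappa> < 1" "1 - \<kappa>\<^sup>2 > 0"
  using hypothesis by (auto simp: hypothesis_I_def power_less_one_iff abs_square_less_1)

lemma norm_g: "norm gp = 1" "norm gm = 1"
  using hypothesis by (auto simp: hypothesis_I_def)

lemma adj_gp: "(gp, \<i> *\<^sub>C gp) \<in> adj A"
  using hypothesis by (simp add: hypothesis_I_def eigenspace_def)

lemma adj_gm: "(gm, (- \<i>) *\<^sub>C gm) \<in> adj A"
  using hypothesis by (simp add: hypothesis_I_def eigenspace_def)

lemma adj_t: "(t, At) \<in> adj A"
  using adj_diff[OF adj_gp adj_scale[OF adj_gm, of \<kappa>]]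
  by (simp add: scaleC_add_right scaleC_scaleC complex_vector.scale_minus_left mult.commute)

lemma adj_s: "(s, As) \<in> adj A"
  using adj_diff[OF adj_scale[OF adj_gp, of \<kappa>] adj_gm]
  by (simp add: scaleC_add_right scaleC_scaleC complex_vector.scale_minus_left mult.commute)

lemma A_subset: "A \<subseteq> T" "A \<subseteq> adj T" "T \<subseteq> adj A"
  using lsystem by (auto simp: is_lsystem_def star_extension_def Lambda_class_def)

lemma B_T: "(f, g) \<in> T \<Longrightarrow> B f = emb A g"
  using lsystem by (auto simp: is_lsystem_def star_extension_def extends_op_def)

lemma adj_B_adj_T: "(f, g) \<in> adj T \<Longrightarrow> adj_pm B f = emb A g"
  using lsystem by (auto simp: is_lsystem_def star_extension_def extends_op_def)

lemma channel_eq: "channel \<Theta> c h = c * cnj (a h)"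
  using lsystem by (intro adj_channel[where A = A]) (simp add: is_lsystem_def)

lemma a_add: "f \<in> hplus A \<Longrightarrow> h \<in> hplus A \<Longrightarrow> a (f + h) = a f + a h"
  and a_scale: "f \<in> hplus A \<Longrightarrow> a (c *\<^sub>C f) = c * a f"
  and a_outside: "h \<notin> hplus A \<Longrightarrow> a h = 0"
proof -
  have "channel \<Theta> 1 \<in> hminus A"
    using lsystem by (simp add: is_lsystem_def bounded_channel_def)
  note hminusD[OF this]
  then show "f \<in> hplus A \<Longrightarrow> h \<in> hplus A \<Longrightarrow> a (f + h) = a f + a h"
    and "f \<in> hplus A \<Longrightarrow> a (c *\<^sub>C f) = c * a f"
    and "h \<notin> hplus A \<Longrightarrow> a h = 0"
    by (simp_all add: adj_channel_def)
qed

lemma a_diff: "f \<in> hplus A \<Longrightarrow> h \<in> hplus A \<Longrightarrow> a (f - h) = a f - a h"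
  using a_add[of f "(-1) *\<^sub>C h"] a_scale[of h "-1"] hplus_scale[of h A "-1"]
  by (simp add: complex_vector.scale_minus_left scaleC_one)

lemma Im_pm_eq: "f \<in> hplus A \<Longrightarrow> Im_pm B f h = a f * cnj (a h)"
  using lsystem channel_eq by (simp add: is_lsystem_def)

text \<open>Re B = B - i Im B, and likewise Re B is the adjoint of B plus i Im B, with Im B of rank
  one. The two forms serve on the domains of T and of its adjoint.\<close>

lemma Re_pm_eq_B: "f \<in> hplus A \<Longrightarrow> R f h = B f h - \<i> * a f * cnj (a h)"
  using Im_pm_eq[of f h] by (simp add: Re_pm_def Im_pm_def field_simps)

lemma Re_pm_eq_adj_B: "f \<in> hplus A \<Longrightarrow> R f h = adj_pm B f h + \<i> * a f * cnj (a h)"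
  using Im_pm_eq[of f h] by (simp add: Re_pm_def Im_pm_def field_simps)

lemma t_in_T: "(t, At) \<in> T"
proof -
  have "gp - \<kappa> *\<^sub>R gm = t"
    by (simp add: scaleC_of_real)
  then have "t \<in> Domain T"
    using hypothesis by (simp add: hypothesis_I_def)
  then obtain g where "(t, g) \<in> T" by blast
  moreover from this have "g = At"
    using A_subset(3) adj_t dense_A adj_single_valued by blast
  ultimately show ?thesis by simp
qed

text \<open>The boundary form of \<open>t\<close> and \<open>s\<close> vanishes because the diagonal
  terms \<kappa> - \<kappa> cancel; this explains the coefficients of \<open>s\<close> and puts it
  in the domain of the adjoint of T.\<close>

lemma cinner_At_s: "cinner At s = cinner t As"
  using norm_g
  by (simp add: cinner.add_left cinner.add_right cinner.diff_left cinner.diff_right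
      cinner_scaleC_left cinner_scaleC_right cinner_self algebra_simps)

lemma s_in_adj_T: "(s, As) \<in> adj T"
  unfolding mem_adj_iff
proof clarify
  fix f g assume fg: "(f, g) \<in> T"
  then have "f \<in> dom_plus_span A t"
    using main_domain by (auto simp: scaleC_of_real)
  then obtain f0 g0 c where f0: "(f0, g0) \<in> A" and f: "f = f0 + c *\<^sub>C t"
    by (auto simp: dom_plus_span_def complex_vector.span_singleton)
  have "(f0, g0) \<in> adj A"
    using f0 A_subset(1,3) by blast
  then have "(f, g0 + c *\<^sub>C At) \<in> adj A"
    unfolding f by (intro adj_add adj_scale adj_t)
  moreover have "(f, g) \<in> adj A"
    using fg A_subset(3) by blast
  ultimately have g: "g = g0 + c *\<^sub>C At"
    using adj_single_valued[OF dense_A] by blast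
  show "cinner g s = cinner f As"
    by (simp only: f g cinner.add_left cinner_scaleC_left[of c] adjD[OF adj_s f0] cinner_At_s)
qed

lemma hplus_vectors: "gp \<in> hplus A" "gm \<in> hplus A" "t \<in> hplus A" "s \<in> hplus A"
  using adj_gp adj_gm adj_t adj_s by (blast intro: hplusI)+

lemma Re_pm_t: "h \<in> hplus A \<Longrightarrow> R t h = cinner At h - \<i> * a t * cnj (a h)"
  by (simp only: Re_pm_eq_B[OF hplus_vectors(3)] B_T[OF t_in_T] emb_def if_True)

lemma Re_pm_s: "h \<in> hplus A \<Longrightarrow> R s h = cinner As h + \<i> * a s * cnj (a h)"
  by (simp only: Re_pm_eq_adj_B[OF hplus_vectors(4)] adj_B_adj_T[OF s_in_adj_T] emb_def if_True)

text \<open>Im B at the pair (t, t) is |a t|^2 by the channel identity and Im (At, t) by B t =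
  At.\<close>

lemma cmod_a_t: "(cmod (a t))\<^sup>2 = 1 - \<kappa>\<^sup>2"
proof -
  have "complex_of_real ((cmod (a t))\<^sup>2) = Im_pm B t t"
    by (simp only: Im_pm_eq[OF hplus_vectors(3)] complex_norm_square)
  also have "B t t = cinner At t"
    by (simp only: B_T[OF t_in_T] emb_def hplus_vectors(3) if_True)
  then have "Im_pm B t t = (cinner At t - cnj (cinner At t)) / (2 * \<i>)"
    by (simp only: Im_pm_def adj_pm_def)
  also have "\<dots> = complex_of_real (Im (cinner At t))"
  proof -
    have "w - cnj w = 2 * \<i> * complex_of_real (Im w)" for w
      by (simp add: complex_eq_iff)
    then show ?thesis
      by (simp only:) simp
  qed
  also have "cinner At t = \<i> * (1 - \<kappa>\<^sup>2) - \<i> * \<kappa> * (cinner gp gm - cnj (cinner gp gm))"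
    using norm_g cinner_commute[of gm gp]
    by (simp add: cinner.add_left cinner.add_right cinner.diff_left cinner.diff_right
        cinner_scaleC_left cinner_scaleC_right cinner_self algebra_simps power2_eq_square)
  also have "Im \<dots> = 1 - \<kappa>\<^sup>2"
    by (simp add: complex_diff_cnj)
  finally show ?thesis
    using of_real_eq_iff by blast
qed

section \<open>The quasi-kernel, the channel functional and the impedance formula\<close>

abbreviation "Q \<equiv> quasi_kernel_ls \<Theta>"

lemma Q_iff: "(f, g) \<in> Q \<longleftrightarrow> f \<in> hplus A \<and> R f = emb A g"
  by (simp add: quasi_kernel_def)

sublocale selfadjoint_operator Q
  using lsystem by unfold_locales (simp add: is_lsystem_def star_extension_def)

lemma A_subset_Q: "A \<subseteq> Q"
proof clarify
  fix f g assume fg: "(f, g) \<in> A"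
  have "B f = emb A g" "adj_pm B f = emb A g"
    using fg A_subset B_T adj_B_adj_T by blast+
  then have "R f = emb A g"
    by (auto simp: Re_pm_def)
  moreover have "f \<in> hplus A"
    using fg A_subset hplusI by blast
  ultimately show "(f, g) \<in> Q"
    by (simp add: Q_iff)
qed

lemma Q_subset_adj_A: "Q \<subseteq> adj A"
  using adj_antimono[OF A_subset_Q] by (simp add: adj_Q)

lemma Re_pm_Q: "(f, g) \<in> Q \<Longrightarrow> h \<in> hplus A \<Longrightarrow> R f h = cinner g h"
  by (simp add: Q_iff emb_def)

text \<open>The sum t + s is a multiple of gp - gm and so lies in the domain of \<open>Q\<close>,
  where the real part has no channel component. The rank-one terms at \<open>t\<close> and
  \<open>s\<close> must cancel; testing against \<open>t\<close>, where \<open>a\<close> is nonzero,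
  shows it.\<close>

lemma a_s: "a s = a t"
proof -
  define u where "u = gp - gm"
  define Au where "Au = \<i> *\<^sub>C (gp + gm)"
  have "u \<in> Domain Q"
    using hypothesis by (simp add: hypothesis_I_def u_def)
  then obtain g where g: "(u, g) \<in> Q" by blast
  moreover have "(u, Au) \<in> adj A"
    using adj_diff[OF adj_gp adj_gm]
    by (simp add: u_def Au_def scaleC_add_right complex_vector.scale_minus_left)
  ultimately have "g = Au"
    using Q_subset_adj_A adj_single_valued[OF dense_A] by blast
  with g have uQ: "(u, Au) \<in> Q" by simp
  have sum: "t + s = (1 + \<kappa>) *\<^sub>C u" "At + As = (1 + \<kappa>) *\<^sub>C Au"
    by (simp_all add: u_def Au_def scaleC_add_left scaleC_add_right scaleC_scaleC scaleC_one
        complex_vector.scale_right_diff_distrib algebra_simps)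
  have t: "t \<in> hplus A" and s: "s \<in> hplus A"
    by (rule hplus_vectors)+
  have "R t t + R s t = cinner (At + As) t"
    unfolding Re_pm_add[OF bounded_B t s t, symmetric] sum
    using Re_pm_Q[OF Q_scale[OF uQ] t] by simp
  then have "\<i> * (a s - a t) * cnj (a t) = 0"
    unfolding Re_pm_t[OF t] Re_pm_s[OF t] cinner.add_left by (simp add: algebra_simps)
  moreover have "a t \<noteq> 0"
    using cmod_a_t \<kappa>(3) by auto
  ultimately show ?thesis by simp
qed

lemma gp_combination: "(1 - \<kappa>\<^sup>2) *\<^sub>C gp = t - \<kappa> *\<^sub>C s"
  by (simp add: scaleC_scaleC scaleC_one complex_vector.scale_right_diff_distrib
      complex_vector.scale_left_diff_distrib power2_eq_square)

lemma a_gp: "(1 + \<kappa>) * a gp = a t"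
proof -
  have "(1 - \<kappa>\<^sup>2) * a gp = (1 - \<kappa>) * a t"
    using arg_cong[OF gp_combination, of a]
    by (simp only: a_scale a_diff hplus_vectors hplus_scale a_s) (simp add: algebra_simps)
  then have "complex_of_real (1 - \<kappa>) * ((1 + \<kappa>) * a gp) = complex_of_real (1 - \<kappa>) * a t"
    by (simp add: power2_eq_square algebra_simps)
  then show ?thesis
    using \<kappa> by (simp only: mult_cancel_left of_real_eq_0_iff) simp
qed

text \<open>The real part sends \<open>gp\<close> to i gp minus a multiple of \<open>K 1\<close>.
  This is how the channel vector is reached from inside the domain.\<close>

lemma Re_pm_gp:
  assumes h: "h \<in> hplus A"
  shows "R gp h = \<i> * cinner gp h - \<i> * (a t / (1 - \<kappa>)) * cnj (a h)"
proof -
  have "(1 - \<kappa>\<^sup>2) * R gp h = R t h - \<kappa> * R s h"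
    using arg_cong[OF gp_combination, of "\<lambda>f. R f h"]
    by (simp only: Re_pm_scale[OF bounded_B _ h] Re_pm_diff[OF bounded_B _ _ h] hplus_vectors hplus_scale)
  also have "\<dots> = (1 - \<kappa>\<^sup>2) * (\<i> * cinner gp h) - (1 + \<kappa>) * (\<i> * a t * cnj (a h))"
    unfolding Re_pm_t[OF h] Re_pm_s[OF h] a_s
    by (simp add: cinner.add_left cinner_scaleC_left power2_eq_square algebra_simps)
  finally have "complex_of_real (1 + \<kappa>) * ((1 - \<kappa>) * R gp h)
      = complex_of_real (1 + \<kappa>) * ((1 - \<kappa>) * (\<i> * cinner gp h) - \<i> * a t * cnj (a h))"
    by (simp add: power2_eq_square algebra_simps)
  then have "(1 - \<kappa>) * R gp h = (1 - \<kappa>) * (\<i> * cinner gp h) - \<i> * a t * cnj (a h)"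
    using \<kappa> by (simp only: mult_cancel_left of_real_eq_0_iff) simp
  moreover have "complex_of_real (1 - \<kappa>) \<noteq> 0"
    using \<kappa> by simp
  ultimately show ?thesis
    by (simp add: field_simps)
qed

text \<open>Evaluating the Hermitian form of Re B at \<open>gp\<close> and \<open>r\<close> in both
  orders recovers the channel functional on the domain of \<open>Q\<close>.\<close>

lemma a_Q:
  assumes "(r, p) \<in> Q"
  shows "cnj (a t) * a r = - \<i> * (1 - \<kappa>) * (cinner p gp + \<i> * cinner r gp)"
proof -
  have r: "r \<in> hplus A"
    using assms by (simp add: Q_iff)
  have "R gp r = cnj (cinner p gp)"
    using Re_pm_hermitian[of B gp r] Re_pm_Q[OF assms hplus_vectors(1)] by simp
  then have "\<i> * cinner gp r - \<i> * (a t / (1 - \<kappa>)) * cnj (a r) = cnj (cinner p gp)"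
    unfolding Re_pm_gp[OF r] .
  from arg_cong[OF this, of cnj]
  have "- \<i> * cinner r gp + \<i> * (cnj (a t) / (1 - \<kappa>)) * a r = cinner p gp"
    using cinner_commute[of r gp] by simp
  moreover have "complex_of_real (1 - \<kappa>) \<noteq> 0"
    using \<kappa> by simp
  ultimately have "\<i> * (cnj (a t) * a r) = (1 - \<kappa>) * (cinner p gp + \<i> * cinner r gp)"
    by (simp add: field_simps)
  then have "- \<i> * (\<i> * (cnj (a t) * a r)) = - \<i> * ((1 - \<kappa>) * (cinner p gp + \<i> * cinner r gp))"
    by simp
  then show ?thesis
    by (simp add: mult.assoc)
qed

lemma impedance_eq:
  assumes z: "Im z > 0"
  shows "impedance \<Theta> z = (1 - \<kappa>) / (1 + \<kappa>) * Q_function gp z"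
proof -
  define r where "r = resolvent z gp"
  define c where "c = a t"
  \<comment> \<open>In gp + (z - i) r the terms of Re B - z inside the Hilbert space cancel, leaving
    -i c / (1 - \<kappa>) times \<open>K 1\<close>; the prefactor normalizes this to
    \<open>K 1\<close>.\<close>
  define f where "f = (\<i> * (1 - \<kappa>) / c) *\<^sub>C (gp + (z - \<i>) *\<^sub>C r)"
  have c: "c \<noteq> 0"
    using cmod_a_t \<kappa>(3) by (auto simp: c_def)
  have \<kappa>1: "complex_of_real (1 - \<kappa>) \<noteq> 0" "complex_of_real (1 + \<kappa>) \<noteq> 0"
    using \<kappa> by (simp_all flip: of_real_add)
  have rQ: "(r, gp + z *\<^sub>C r) \<in> Q"
    unfolding r_def using z by (intro resolvent) simp
  then have r: "r \<in> hplus A"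
    by (simp add: Q_iff)
  have gr: "gp + (z - \<i>) *\<^sub>C r \<in> hplus A"
    by (intro hplus_add hplus_scale hplus_vectors r)
  then have f: "f \<in> hplus A"
    unfolding f_def by (rule hplus_scale)
  define G where "G f h = R f h - z * emb A f h" for f h
  have Gf: "G f = channel \<Theta> 1"
  proof
    fix h
    show "G f h = channel \<Theta> 1 h"
    proof (cases "h \<in> hplus A")
      case h: True
      have "R (gp + (z - \<i>) *\<^sub>C r) h = R gp h + (z - \<i>) * cinner (gp + z *\<^sub>C r) h"
        using Re_pm_add[OF bounded_B hplus_vectors(1) hplus_scale[OF r] h] Re_pm_scale[OF bounded_B r h]
          Re_pm_Q[OF rQ h] by simp
      also have "\<dots> = z * cinner (gp + (z - \<i>) *\<^sub>C r) h - \<i> * (c / (1 - \<kappa>)) * cnj (a h)"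
        unfolding Re_pm_gp[OF h] c_def by (simp add: cinner.add_left cinner.diff_left cinner_scaleC_left algebra_simps)
      finally have "R f h = \<i> * (1 - \<kappa>) / c *
          (z * cinner (gp + (z - \<i>) *\<^sub>C r) h - \<i> * (c / (1 - \<kappa>)) * cnj (a h))"
        unfolding f_def Re_pm_scale[OF bounded_B gr h] by simp
      also have "\<dots> = z * cinner f h + cnj (a h)"
      proof -
        have "p * (z * q - u * v) = z * (p * q) - p * u * v" for p q u v
          by (simp add: algebra_simps)
        moreover have "\<i> * (1 - \<kappa>) / c * (\<i> * (c / (1 - \<kappa>))) = -1"
          using c \<kappa>1 by simp
        ultimately show ?thesis
          by (simp only: f_def cinner_scaleC_left) simp
      qed
      finally show ?thesis
        using h by (simp add: G_def emb_def channel_eq)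
    next
      case False
      then show ?thesis
        using Re_pm_outside[OF bounded_B f] by (simp add: G_def emb_def channel_eq a_outside)
    qed
  qed
  \<comment> \<open>\<open>impedance\<close> uses \<open>inv_into\<close>, so \<open>f\<close> must
    be the only preimage; a difference of two preimages would be an eigenvector of \<open>Q\<close>
    at a nonreal point.\<close>
  have inj: "inj_on G (hplus A)"
  proof (rule inj_onI)
    fix f1 f2 assume f12: "f1 \<in> hplus A" "f2 \<in> hplus A" and eq: "G f1 = G f2"
    have "R (f1 - f2) h = emb A (z *\<^sub>C (f1 - f2)) h" for h
    proof (cases "h \<in> hplus A")
      case True
      have "R f1 h - z * cinner f1 h = R f2 h - z * cinner f2 h"
        using fun_cong[OF eq, of h] True by (simp add: G_def emb_def)
      then have "R f1 h - R f2 h = z * (cinner f1 h - cinner f2 h)"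
        by algebra
      then show ?thesis
        unfolding Re_pm_diff[OF bounded_B f12 True]
        using True by (simp only: emb_def if_True cinner.diff_left cinner_scaleC_left)
    next
      case False
      then show ?thesis
        using Re_pm_outside[OF bounded_B hplus_diff[OF f12]] by (simp add: emb_def)
    qed
    then have "(f1 - f2, z *\<^sub>C (f1 - f2)) \<in> Q"
      using hplus_diff[OF f12] by (auto simp: Q_iff)
    then show "f1 = f2"
      using eigenvector_eq_0[of "f1 - f2" z] z by simp
  qed
  have "impedance \<Theta> z = a (inv_into (hplus A) G (G f))"
    unfolding Gf by (simp add: impedance_def G_def[abs_def])
  also have "\<dots> = a f"
    using inj f by simp
  also have "\<dots> = \<i> * (1 - \<kappa>) / c * (a gp + (z - \<i>) * a r)"
    by (simp only: f_def a_scale[OF gr] a_add[OF hplus_vectors(1) hplus_scale[OF r]] a_scale[OF r])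
  also have "a gp = c / (1 + \<kappa>)"
    using a_gp \<kappa>1 by (simp add: c_def field_simps)
  also have "a r = - \<i> * (1 - \<kappa>) * (cinner (gp + z *\<^sub>C r) gp + \<i> * cinner r gp) / cnj c"
    using a_Q[OF rQ] c by (simp add: c_def field_simps)
  also have "cinner (gp + z *\<^sub>C r) gp + \<i> * cinner r gp = 1 + (z + \<i>) * cinner r gp"
    by (simp add: cinner.add_left cinner_scaleC_left cinner_self norm_g algebra_simps)
  also have "\<i> * (1 - \<kappa>) / c * (c / (1 + \<kappa>) + (z - \<i>) *
        (- \<i> * (1 - \<kappa>) * (1 + (z + \<i>) * cinner r gp) / cnj c))
      = \<i> * ((1 - \<kappa>) / (1 + \<kappa>)) + (1 - \<kappa>)\<^sup>2 / (c * cnj c) * ((z - \<i>) * (1 + (z + \<i>) * cinner r gp))"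
    using c \<kappa>1 by (simp add: field_simps power2_eq_square)
  \<comment> \<open>The modulus of \<open>c\<close> gives both summands the common factor (1 -
    \<kappa>) / (1 + \<kappa>).\<close>
  also have "c * cnj c = (1 - \<kappa>) * (1 + \<kappa>)"
    unfolding complex_norm_square[symmetric] c_def cmod_a_t by (simp add: power2_eq_square algebra_simps)
  also have "complex_of_real ((1 - \<kappa>)\<^sup>2) / ((1 - \<kappa>) * (1 + \<kappa>)) = (1 - \<kappa>) / (1 + \<kappa>)"
    using \<kappa>1 by (simp add: power2_eq_square)
  also have "\<i> * ((1 - \<kappa>) / (1 + \<kappa>)) + complex_of_real ((1 - \<kappa>) / (1 + \<kappa>)) * ((z - \<i>) * (1 + (z + \<i>) * cinner r gp))
      = (1 - \<kappa>) / (1 + \<kappa>) * (\<i> + (z - \<i>) * (1 + (z + \<i>) * cinner r gp))"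
    by (simp add: algebra_simps)
  also have "\<i> + (z - \<i>) * (1 + (z + \<i>) * cinner r gp) = Q_function gp z"
    unfolding Q_function_def r_def[symmetric] by (simp add: algebra_simps power2_eq_square)
  finally show ?thesis .
qed

theorem impedance_class_M: "impedance \<Theta> \<in> class_M \<kappa>"
proof -
  define q where "q = (1 - \<kappa>) / (1 + \<kappa>)"
  have q: "q > 0"
    using \<kappa> by (simp add: q_def)
  have imp: "impedance \<Theta> z = q * Q_function gp z" if "Im z > 0" for z
    using impedance_eq[OF that] by (simp add: q_def)
  obtain \<nu> where \<nu>: "real_distribution \<nu>"
    and rep: "\<And>z. Im z > 0 \<Longrightarrow>
      Q_function gp z = (CLINT x|\<nu>. (1 + complex_of_real x * z) / (complex_of_real x - z))"
    using Q_function_representation[OF norm_g(1)] by blast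
  interpret \<nu>: real_distribution \<nu> by (rule \<nu>)
  \<comment> \<open>The kernel (1 + x z) / (x - z) equals (1 + x^2) times the kernel of the class,
    so the weight 1 + x^2 goes into the measure. The weighted total mass is then q, as \<nu> is a
    probability.\<close>
  define \<mu> where "\<mu> = density \<nu> (\<lambda>x. ennreal (q * (1 + x\<^sup>2)))"
  have pos: "1 + x\<^sup>2 > 0" for x :: real
    by (simp add: add_pos_nonneg)
  have weight: "q * (1 + x\<^sup>2) \<ge> 0" for x
    using q pos[of x] by (simp add: less_imp_le)
  have "impedance \<Theta> analytic_on {z. Im z > 0}"
  proof -
    have "(\<lambda>z. q * Q_function gp z) holomorphic_on {z. Im z > 0}"
      by (intro holomorphic_intros Q_function_holomorphic norm_g)
    then have "impedance \<Theta> holomorphic_on {z. Im z > 0}"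
      by (rule holomorphic_transform) (simp add: imp)
    then show ?thesis
      by (simp add: analytic_on_open open_halfspace_Im_gt)
  qed
  moreover have "Im (impedance \<Theta> z) > 0" if z: "Im z > 0" for z
    using imp[OF z] q Im_Q_function_pos[OF \<nu> rep z] by simp
  moreover have "sets \<mu> = sets borel"
    by (simp add: \<mu>_def)
  moreover have "emeasure \<mu> UNIV = \<infinity>"
  proof (rule ccontr)
    assume "emeasure \<mu> UNIV \<noteq> \<infinity>"
    moreover have "emeasure \<mu> UNIV = (\<integral>\<^sup>+x. ennreal (q * (1 + x\<^sup>2)) \<partial>\<nu>)"
      by (simp add: \<mu>_def emeasure_density)
    ultimately have "(\<integral>\<^sup>+x. ennreal (norm (q * (1 + x\<^sup>2))) \<partial>\<nu>) < \<infinity>"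
      using weight by (simp add: top.not_eq_extremum)
    then have "integrable \<nu> (\<lambda>x. q * (1 + x\<^sup>2))"
      by (intro integrableI_bounded) auto
    then have int: "integrable \<nu> (\<lambda>x. 1 + x\<^sup>2)"
      using q by simp
    show False
    \<comment> \<open>If \<mu> were finite, 1 + x^2 would be \<nu>-integrable, and y (1 + x^2) /
      (x^2 + y^2) is at most (1 + x^2) / y; its integral supplies the constant
      \<open>D\<close>.\<close>
    proof (rule deficiency_vector_unbounded[OF A_subset_Q dense_A adj_gp norm_g(1)])
      fix y :: real assume y: "y > 0"
      have Im: "Im (\<i> * complex_of_real y) > 0"
        using y by simp
      have "Im (Q_function gp (\<i> * complex_of_real y)) = (\<integral>x. Im (\<i> * complex_of_real y) * (1 + x\<^sup>2) /
          (cmod (complex_of_real x - \<i> * complex_of_real y))\<^sup>2 \<partial>\<nu>)"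
        by (intro Im_Q_function(1) \<nu> rep Im)
      also have "\<dots> \<le> (\<integral>x. (1 + x\<^sup>2) / y \<partial>\<nu>)"
      proof (rule integral_mono)
        show "integrable \<nu> (\<lambda>x. (1 + x\<^sup>2) / y)"
          using int by simp
        fix x
        have "Im (\<i> * complex_of_real y) * (1 + x\<^sup>2) / (cmod (complex_of_real x - \<i> * complex_of_real y))\<^sup>2
            = y * (1 + x\<^sup>2) / (x\<^sup>2 + y\<^sup>2)"
          unfolding cmod_power2 by simp
        also have "\<dots> \<le> y * (1 + x\<^sup>2) / y\<^sup>2"
          using y pos[of x] by (intro divide_left_mono mult_pos_pos) (auto simp: add_nonneg_pos)
        also have "\<dots> = (1 + x\<^sup>2) / y"
          by (simp add: power2_eq_square)
        finally show "Im (\<i> * complex_of_real y) * (1 + x\<^sup>2) / (cmod (complex_of_real x - \<i> * complex_of_real y))\<^sup>2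
            \<le> (1 + x\<^sup>2) / y" .
      qed (intro Im_Q_function(2)[of \<nu> gp] \<nu> rep Im)
      finally show "Im (Q_function gp (\<i> * complex_of_real y)) \<le> (\<integral>x. 1 + x\<^sup>2 \<partial>\<nu>) / y"
        by simp
    qed
  qed
  moreover have "(\<integral>\<^sup>+x. ennreal (1 / (1 + x\<^sup>2)) \<partial>\<mu>) = ennreal ((1 - \<kappa>) / (1 + \<kappa>))"
  proof -
    have "(\<integral>\<^sup>+x. ennreal (1 / (1 + x\<^sup>2)) \<partial>\<mu>) = (\<integral>\<^sup>+x. ennreal (q * (1 + x\<^sup>2)) * ennreal (1 / (1 + x\<^sup>2)) \<partial>\<nu>)"
      unfolding \<mu>_def by (intro nn_integral_density) auto
    also have "\<dots> = (\<integral>\<^sup>+x. ennreal q \<partial>\<nu>)"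
    proof (intro nn_integral_cong)
      fix x
      have "ennreal (q * (1 + x\<^sup>2)) * ennreal (1 / (1 + x\<^sup>2)) = ennreal (q * (1 + x\<^sup>2) * (1 / (1 + x\<^sup>2)))"
        using weight[of x] by (intro ennreal_mult'[symmetric])
      also have "q * (1 + x\<^sup>2) * (1 / (1 + x\<^sup>2)) = q"
        using pos[of x] by simp
      finally show "ennreal (q * (1 + x\<^sup>2)) * ennreal (1 / (1 + x\<^sup>2)) = ennreal q" .
    qed
    finally show ?thesis
      using \<nu>.emeasure_space_1 by (simp add: q_def)
  qed
  moreover have "impedance \<Theta> z = (LINT x|\<mu>. 1 / (complex_of_real x - z) - complex_of_real (x / (1 + x\<^sup>2)))"
    if z: "Im z > 0" for z
  proof -
    have "(LINT x|\<mu>. 1 / (complex_of_real x - z) - complex_of_real (x / (1 + x\<^sup>2)))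
        = (LINT x|\<nu>. (q * (1 + x\<^sup>2)) *\<^sub>R (1 / (complex_of_real x - z) - complex_of_real (x / (1 + x\<^sup>2))))"
      unfolding \<mu>_def by (intro integral_density) (auto simp: weight)
    also have "\<dots> = (LINT x|\<nu>. q * ((1 + complex_of_real x * z) / (complex_of_real x - z)))"
    proof (intro Bochner_Integration.integral_cong refl)
      fix x
      define X where "X = complex_of_real x"
      have nz: "X - z \<noteq> 0"
        using z by (auto simp: X_def complex_eq_iff)
      have X: "1 + X\<^sup>2 \<noteq> 0"
      proof -
        have "1 + X\<^sup>2 = complex_of_real (1 + x\<^sup>2)"
          by (simp add: X_def)
        then show ?thesis
          using pos[of x] by (simp only: of_real_eq_0_iff)
      qed
      have "(1 + X\<^sup>2) * (1 / (X - z) - X / (1 + X\<^sup>2)) = (1 + X\<^sup>2) / (X - z) - X"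
        using X by (simp add: right_diff_distrib)
      also have "\<dots> = (1 + X * z) / (X - z)"
        using nz by (simp add: field_simps power2_eq_square)
      finally show "(q * (1 + x\<^sup>2)) *\<^sub>R (1 / (complex_of_real x - z) - complex_of_real (x / (1 + x\<^sup>2)))
          = q * ((1 + complex_of_real x * z) / (complex_of_real x - z))"
        by (simp add: X_def scaleR_conv_of_real mult.assoc)
    qed
    also have "\<dots> = impedance \<Theta> z"
      unfolding imp[OF z] rep[OF z] by (rule integral_mult_right_zero)
    finally show ?thesis ..
  qed
  ultimately show ?thesis
    unfolding class_M_def using \<kappa>(1,2) by (intro CollectI conjI exI[of _ \<mu>] allI impI) auto
qed

end

section \<open>The coupling\<close>

lemma adj_op_sumI: "(f1, g1) \<in> adj A1 \<Longrightarrow> (f2, g2) \<in> adj A2 \<Longrightarrow> ((f1, f2), (g1, g2)) \<in> adj (op_sum A1 A2)"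
  by (subst mem_adj_iff) (clarsimp simp: op_sum_def cinner_prod_def, simp add: adjD[of f1 g1] adjD[of f2 g2])

lemma densely_defined_op_sum:
  assumes "densely_defined A1" "densely_defined A2"
  shows "densely_defined (op_sum A1 A2)"
proof -
  have "Domain (op_sum A1 A2) = Domain A1 \<times> Domain A2"
    by (auto simp: op_sum_def Domain_iff)
  then show ?thesis
    using assms by (simp add: densely_defined_def closure_Times)
qed

lemma op_sum_subset_adj: "A1 \<subseteq> adj A1 \<Longrightarrow> A2 \<subseteq> adj A2 \<Longrightarrow> op_sum A1 A2 \<subseteq> adj (op_sum A1 A2)"
  by (auto simp: op_sum_def[of A1 A2] intro!: adj_op_sumI[of _ _ A1 _ _ A2, unfolded op_sum_def])

text \<open>Extending \<open>S\<close> by one vector \<open>l\<close> shrinks the adjoint by one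
  linear condition, the pairing with \<open>l\<close>.\<close>

lemma eigenvector_adj_restriction:
  assumes S: "densely_defined S" "S \<subseteq> adj S" and l: "(l, l') \<in> adj S"
    and G: "(G, z *\<^sub>C G) \<in> adj S" and eq: "cinner l' G = cinner l (z *\<^sub>C G)"
  shows "(G, z *\<^sub>C G) \<in> adj (restrict_op (adj S) (dom_plus_span S l))"
  unfolding mem_adj_iff
proof clarify
  fix f g assume "(f, g) \<in> restrict_op (adj S) (dom_plus_span S l)"
  then have fg: "(f, g) \<in> adj S" and "f \<in> dom_plus_span S l"
    by (auto simp: restrict_op_def)
  then obtain f0 g0 c where f0: "(f0, g0) \<in> S" and f: "f = f0 + c *\<^sub>C l"
    by (auto simp: dom_plus_span_def complex_vector.span_singleton)
  have "(f, g0 + c *\<^sub>C l') \<in> adj S"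
    unfolding f using f0 S(2) by (intro adj_add adj_scale l) auto
  then have g: "g = g0 + c *\<^sub>C l'"
    using adj_single_valued[OF S(1) fg] by simp
  show "cinner g G = cinner f (z *\<^sub>C G)"
    by (simp only: f g cinner.add_left cinner_scaleC_left adjD[OF G f0] eq)
qed

text \<open>Merges the cases \<kappa>2 = 0 and \<kappa>2 nonzero. The two scalar identities say that
  the boundary form of the coupling vector with the two deficiency vectors vanishes.\<close>

lemma coupling_vector_coefficients:
  assumes "coupling_angles \<kappa>1 \<kappa>2 \<alpha> \<beta>"
  obtains x y w :: real where
    "coupling_vector \<kappa>1 \<kappa>2 \<alpha> gp1 gm1 gp2 gm2 = (x *\<^sub>C (gp1 - \<kappa>1 *\<^sub>C gm1), y *\<^sub>C gp2 - w *\<^sub>C gm2)"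
    "x * cos \<alpha> = y * sin \<alpha>" "x * (\<kappa>1 * cos \<beta>) = w * sin \<beta>"
proof (cases "\<kappa>2 = 0")
  case True
  then have \<alpha>: "\<alpha> = pi / 2" and "sin \<beta> = \<kappa>1" "cos \<beta> = sqrt (1 - \<kappa>1\<^sup>2)"
    using assms by (auto simp: coupling_angles_def)
  moreover have "cos \<alpha> = 0"
    unfolding \<alpha> by (rule cos_pi_half)
  moreover have "coupling_vector \<kappa>1 \<kappa>2 \<alpha> gp1 gm1 gp2 gm2
      = (1 *\<^sub>C (gp1 - \<kappa>1 *\<^sub>C gm1), 0 *\<^sub>C gp2 - sqrt (1 - \<kappa>1\<^sup>2) *\<^sub>C gm2)"
    using True by (simp add: coupling_vector_def scaleC_of_real scaleC_one)
  ultimately show ?thesis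
    using that[of 1 0 "sqrt (1 - \<kappa>1\<^sup>2)"] by simp
next
  case False
  then have "sin \<beta> = \<kappa>1 * sin \<alpha>" "cos \<beta> = 1 / \<kappa>2 * cos \<alpha>"
    using assms by (auto simp: coupling_angles_def)
  moreover have "coupling_vector \<kappa>1 \<kappa>2 \<alpha> gp1 gm1 gp2 gm2
      = (sin \<alpha> *\<^sub>C (gp1 - \<kappa>1 *\<^sub>C gm1), cos \<alpha> *\<^sub>C gp2 - (cos \<alpha> / \<kappa>2) *\<^sub>C gm2)"
    using False by (simp add: coupling_vector_def scaleC_of_real scaleR_diff_right flip: of_real_divide)
  ultimately show ?thesis
    using that[of "sin \<alpha>" "cos \<alpha>" "cos \<alpha> / \<kappa>2"] by simp
qed

lemma coupling_deficiency_vectors: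
  fixes gp1 gm1 :: "'a::chilbert_space" and gp2 gm2 :: "'b::chilbert_space"
  assumes angles: "coupling_angles \<kappa>1 \<kappa>2 \<alpha> \<beta>"
    and sym: "symmetric_op A1" "symmetric_op A2"
    and eig: "(gp1, \<i> *\<^sub>C gp1) \<in> adj A1" "(gm1, (- \<i>) *\<^sub>C gm1) \<in> adj A1"
      "(gp2, \<i> *\<^sub>C gp2) \<in> adj A2" "(gm2, (- \<i>) *\<^sub>C gm2) \<in> adj A2"
    and norms: "norm gp1 = 1" "norm gm1 = 1" "norm gp2 = 1" "norm gm2 = 1"
  defines "A \<equiv> coupling_sym_op A1 A2 (coupling_vector \<kappa>1 \<kappa>2 \<alpha> gp1 gm1 gp2 gm2)"
    and "Gp \<equiv> (cos \<alpha> *\<^sub>R gp1, - sin \<alpha> *\<^sub>R gp2)"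
    and "Gm \<equiv> (cos \<beta> *\<^sub>R gm1, - sin \<beta> *\<^sub>R gm2)"
  shows "(Gp, \<i> *\<^sub>C Gp) \<in> adj (op_sum A1 A2)" "(Gm, (- \<i>) *\<^sub>C Gm) \<in> adj (op_sum A1 A2)"
    and "(Gp, \<i> *\<^sub>C Gp) \<in> adj A" "(Gm, (- \<i>) *\<^sub>C Gm) \<in> adj A"
    and "norm Gp = 1" "norm Gm = 1"
proof -
  obtain x y w :: real where
    l: "coupling_vector \<kappa>1 \<kappa>2 \<alpha> gp1 gm1 gp2 gm2 = (x *\<^sub>C (gp1 - \<kappa>1 *\<^sub>C gm1), y *\<^sub>C gp2 - w *\<^sub>C gm2)"
    and orth: "x * cos \<alpha> = y * sin \<alpha>" "x * (\<kappa>1 * cos \<beta>) = w * sin \<beta>"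
    using coupling_vector_coefficients[OF angles] by blast
  \<comment> \<open>The value of the adjoint of the direct sum at the coupling vector.\<close>
  define l' where "l' = (x *\<^sub>C \<i> *\<^sub>C (gp1 + \<kappa>1 *\<^sub>C gm1), \<i> *\<^sub>C (y *\<^sub>C gp2 + w *\<^sub>C gm2))"
  have S: "densely_defined (op_sum A1 A2)" "op_sum A1 A2 \<subseteq> adj (op_sum A1 A2)"
    using sym by (auto simp: symmetric_op_def intro!: densely_defined_op_sum op_sum_subset_adj[THEN subsetD])
  have "(x *\<^sub>C (gp1 - \<kappa>1 *\<^sub>C gm1), x *\<^sub>C (\<i> *\<^sub>C gp1 - \<kappa>1 *\<^sub>C (- \<i>) *\<^sub>C gm1)) \<in> adj A1"
    by (intro adj_scale adj_diff eig)
  moreover have "(y *\<^sub>C gp2 - w *\<^sub>C gm2, y *\<^sub>C \<i> *\<^sub>C gp2 - w *\<^sub>C (- \<i>) *\<^sub>C gm2) \<in> adj A2"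
    by (intro adj_scale adj_diff eig)
  ultimately have ll': "((x *\<^sub>C (gp1 - \<kappa>1 *\<^sub>C gm1), y *\<^sub>C gp2 - w *\<^sub>C gm2), l') \<in> adj (op_sum A1 A2)"
    using adj_op_sumI unfolding l'_def
    by (fastforce simp: scaleC_add_right scaleC_scaleC complex_vector.scale_minus_left mult.commute)
  have Gp: "Gp = (cos \<alpha> *\<^sub>C gp1, (- sin \<alpha>) *\<^sub>C gp2)" and Gm: "Gm = (cos \<beta> *\<^sub>C gm1, (- sin \<beta>) *\<^sub>C gm2)"
    unfolding Gp_def Gm_def by (simp_all only: scaleC_of_real)
  have scale: "z *\<^sub>C (c *\<^sub>C u, d *\<^sub>C v) = (c *\<^sub>C z *\<^sub>C u, d *\<^sub>C z *\<^sub>C v)" for z c d and u :: 'a and v :: 'b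
    by (simp add: scaleC_prod_def scaleC_scaleC mult.commute)
  show GpS: "(Gp, \<i> *\<^sub>C Gp) \<in> adj (op_sum A1 A2)"
    unfolding Gp scale by (intro adj_op_sumI adj_scale eig)
  show GmS: "(Gm, (- \<i>) *\<^sub>C Gm) \<in> adj (op_sum A1 A2)"
    unfolding Gm scale by (intro adj_op_sumI adj_scale eig)
  note expand = cinner_prod_def cinner.add_left cinner.add_right cinner.diff_left cinner.diff_right
    cinner_scaleC_left cinner_scaleC_right cinner_self norms
    cinner.minus_left cinner.minus_right
  have orthC: "complex_of_real x * cos \<alpha> = y * sin \<alpha>"
    "complex_of_real x * (\<kappa>1 * cos \<beta>) = w * sin \<beta>"
    using orth by (simp_all flip: of_real_mult)
  have "cinner l' Gp - cinner (x *\<^sub>C (gp1 - \<kappa>1 *\<^sub>C gm1), y *\<^sub>C gp2 - w *\<^sub>C gm2) (\<i> *\<^sub>C Gp)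
      = 2 * \<i> * (complex_of_real x * cos \<alpha> - y * sin \<alpha>)"
    unfolding l'_def Gp scale by (simp add: expand algebra_simps)
  then have eqp: "cinner l' Gp = cinner (x *\<^sub>C (gp1 - \<kappa>1 *\<^sub>C gm1), y *\<^sub>C gp2 - w *\<^sub>C gm2) (\<i> *\<^sub>C Gp)"
    by (simp only: orthC diff_self mult_zero_right right_minus_eq)
  have "cinner l' Gm - cinner (x *\<^sub>C (gp1 - \<kappa>1 *\<^sub>C gm1), y *\<^sub>C gp2 - w *\<^sub>C gm2) ((- \<i>) *\<^sub>C Gm)
      = 2 * \<i> * (complex_of_real x * (\<kappa>1 * cos \<beta>) - w * sin \<beta>)"
    unfolding l'_def Gm scale by (simp add: expand algebra_simps)
  then have eqm: "cinner l' Gm = cinner (x *\<^sub>C (gp1 - \<kappa>1 *\<^sub>C gm1), y *\<^sub>C gp2 - w *\<^sub>C gm2) ((- \<i>) *\<^sub>C Gm)"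
    by (simp only: orthC diff_self mult_zero_right right_minus_eq)
  show "(Gp, \<i> *\<^sub>C Gp) \<in> adj A" "(Gm, (- \<i>) *\<^sub>C Gm) \<in> adj A"
    unfolding A_def coupling_sym_op_def l
    by (rule eigenvector_adj_restriction[OF S ll' GpS eqp] eigenvector_adj_restriction[OF S ll' GmS eqm])+
  show "norm Gp = 1" "norm Gm = 1"
    unfolding Gp_def Gm_def by (simp_all add: norm_Pair norms)
qed

theorem theorem6p5:
  fixes \<Theta>\<^sub>1 :: "'a::chilbert_space lsystem"
    and \<Theta>\<^sub>2 :: "'b::chilbert_space lsystem"
    and \<Theta> :: "('a \<times> 'b) lsystem"
    and gp\<^sub>1 gm\<^sub>1 :: 'a and gp\<^sub>2 gm\<^sub>2 :: 'b
    and \<kappa>\<^sub>1 \<kappa>\<^sub>2 :: real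
  assumes "minimal_lsystem \<Theta>\<^sub>1" and "minimal_lsystem \<Theta>\<^sub>2"
    and "hypothesis_I \<Theta>\<^sub>1 gp\<^sub>1 gm\<^sub>1 \<kappa>\<^sub>1" and "hypothesis_I \<Theta>\<^sub>2 gp\<^sub>2 gm\<^sub>2 \<kappa>\<^sub>2"
    and "is_coupling \<Theta>\<^sub>1 gp\<^sub>1 gm\<^sub>1 \<kappa>\<^sub>1 \<Theta>\<^sub>2 gp\<^sub>2 gm\<^sub>2 \<kappa>\<^sub>2 \<Theta>"
    and "impedance \<Theta>\<^sub>1 \<in> class_M \<kappa>\<^sub>1" and "impedance \<Theta>\<^sub>2 \<in> class_M \<kappa>\<^sub>2"
  shows "impedance \<Theta> \<in> class_M (\<kappa>\<^sub>1 * \<kappa>\<^sub>2)"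
proof -
  define S where "S = op_sum (sym_op \<Theta>\<^sub>1) (sym_op \<Theta>\<^sub>2)"
  obtain \<alpha> \<beta> where angles: "coupling_angles \<kappa>\<^sub>1 \<kappa>\<^sub>2 \<alpha> \<beta>"
    and coupling: "let Gp = (cos \<alpha> *\<^sub>R gp\<^sub>1, - sin \<alpha> *\<^sub>R gp\<^sub>2);
        Gm = (cos \<beta> *\<^sub>R gm\<^sub>1, - sin \<beta> *\<^sub>R gm\<^sub>2);
        A = coupling_sym_op (sym_op \<Theta>\<^sub>1) (sym_op \<Theta>\<^sub>2)
          (coupling_vector \<kappa>\<^sub>1 \<kappa>\<^sub>2 \<alpha> gp\<^sub>1 gm\<^sub>1 gp\<^sub>2 gm\<^sub>2)
      in is_lsystem \<Theta> \<and> sym_op \<Theta> = A \<and>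
        main_op \<Theta> = restrict_op (adj S) (dom_plus_span A (Gp - (\<kappa>\<^sub>1 * \<kappa>\<^sub>2) *\<^sub>R Gm)) \<and>
        Gp - Gm \<in> Domain (quasi_kernel_ls \<Theta>)"
    using assms(5) unfolding is_coupling_def Let_def S_def 
    by blast
  define Gp where "Gp = (cos \<alpha> *\<^sub>R gp\<^sub>1, - sin \<alpha> *\<^sub>R gp\<^sub>2)"
  define Gm where "Gm = (cos \<beta> *\<^sub>R gm\<^sub>1, - sin \<beta> *\<^sub>R gm\<^sub>2)"
  note G = Gp_def Gm_def
  have \<Theta>: "is_lsystem \<Theta>"
    and A: "sym_op \<Theta> = coupling_sym_op (sym_op \<Theta>\<^sub>1) (sym_op \<Theta>\<^sub>2)
      (coupling_vector \<kappa>\<^sub>1 \<kappa>\<^sub>2 \<alpha> gp\<^sub>1 gm\<^sub>1 gp\<^sub>2 gm\<^sub>2)"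
    and T: "main_op \<Theta> = restrict_op (adj S) (dom_plus_span (sym_op \<Theta>) (Gp - (\<kappa>\<^sub>1 * \<kappa>\<^sub>2) *\<^sub>R Gm))"
    and Q: "Gp - Gm \<in> Domain (quasi_kernel_ls \<Theta>)"
    using coupling unfolding Let_def G by (elim conjE; simp only:)+
  have sym: "symmetric_op (sym_op \<Theta>\<^sub>1)" "symmetric_op (sym_op \<Theta>\<^sub>2)"
    using assms(1,2) by (simp_all add: minimal_lsystem_def is_lsystem_def)
  have H1: "(gp\<^sub>1, \<i> *\<^sub>C gp\<^sub>1) \<in> adj (sym_op \<Theta>\<^sub>1)" "(gm\<^sub>1, (- \<i>) *\<^sub>C gm\<^sub>1) \<in> adj (sym_op \<Theta>\<^sub>1)"
      "norm gp\<^sub>1 = 1" "norm gm\<^sub>1 = 1" "0 \<le> \<kappa>\<^sub>1" "\<kappa>\<^sub>1 < 1"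
    and H2: "(gp\<^sub>2, \<i> *\<^sub>C gp\<^sub>2) \<in> adj (sym_op \<Theta>\<^sub>2)" "(gm\<^sub>2, (- \<i>) *\<^sub>C gm\<^sub>2) \<in> adj (sym_op \<Theta>\<^sub>2)"
      "norm gp\<^sub>2 = 1" "norm gm\<^sub>2 = 1" "0 \<le> \<kappa>\<^sub>2" "\<kappa>\<^sub>2 < 1"
    using assms(3,4) by (simp_all add: hypothesis_I_def eigenspace_def)
  note def = coupling_deficiency_vectors[OF angles sym H1(1,2) H2(1,2) H1(3,4) H2(3,4),
      folded G S_def A]
  have "Gp - (\<kappa>\<^sub>1 * \<kappa>\<^sub>2) *\<^sub>R Gm \<in> Domain (adj S)"
    using adj_diff[OF def(1) adj_scale[OF def(2), of "complex_of_real (\<kappa>\<^sub>1 * \<kappa>\<^sub>2)"]]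
    unfolding scaleC_of_real by blast
  \<comment> \<open>Allows the boundary vector itself to be written as 0 plus an element of the
    span.\<close>
  moreover have "0 \<in> Domain (sym_op \<Theta>)"
  proof -
    have "complex_vector.subspace (sym_op \<Theta>)"
      using \<Theta> by (simp add: is_lsystem_def symmetric_op_def linear_operator_def)
    then have "(0, 0) \<in> sym_op \<Theta>"
      using complex_vector.subspace_0 by (metis zero_prod_def)
    then show ?thesis by blast
  qed
  then have "Gp - (\<kappa>\<^sub>1 * \<kappa>\<^sub>2) *\<^sub>R Gm \<in> dom_plus_span (sym_op \<Theta>) (Gp - (\<kappa>\<^sub>1 * \<kappa>\<^sub>2) *\<^sub>R Gm)"
    unfolding dom_plus_span_def
    by (intro CollectI exI conjI) (rule add_0[symmetric], assumption, auto intro: complex_vector.span_base)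
  ultimately have "Gp - (\<kappa>\<^sub>1 * \<kappa>\<^sub>2) *\<^sub>R Gm \<in> Domain (main_op \<Theta>)"
    unfolding T by (auto simp: restrict_op_def)
  moreover have "\<kappa>\<^sub>1 * \<kappa>\<^sub>2 < 1"
    using H1(5,6) H2(5,6) mult_strict_mono'[of \<kappa>\<^sub>1 1 \<kappa>\<^sub>2 1] by simp
  ultimately have "hypothesis_I \<Theta> Gp Gm (\<kappa>\<^sub>1 * \<kappa>\<^sub>2)"
    unfolding hypothesis_I_def eigenspace_def using def(3-6) Q H1(5) H2(5) by simp
  \<comment> \<open>T is a restriction to exactly this sum, which supplies
    \<open>main_domain\<close>; the parameter \<kappa>1 \<kappa>2 is read off the spanning
    vector.\<close>
  moreover have "Domain (main_op \<Theta>) \<subseteq> dom_plus_span (sym_op \<Theta>) (Gp - (\<kappa>\<^sub>1 * \<kappa>\<^sub>2) *\<^sub>R Gm)"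
    unfolding T by (auto simp: restrict_op_def)
  ultimately interpret lsystem_hypothesis_I \<Theta> Gp Gm "\<kappa>\<^sub>1 * \<kappa>\<^sub>2"
    using \<Theta> by unfold_locales
  show ?thesis
    by (rule impedance_class_M)
qed

end
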